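(* Let $k$ be a field. Then $$\mathcal{GPH}^2(k_0,k)\cong k^*\sqcup k\sqcup k^*\qquad\text{and}\qquad\mathcal{GPH}^2(k_1,k)\cong\{*\}\sqcup\{*\}\sqcup k\sqcup k\sqcup k^*,$$ where $\{*\}$ denotes the singleton set. Explicitly, any $2$-dimensional co-flag Poisson algebra is cohomologous to one of the following Poisson algebras with basis $\{e_1,e_2\}$, multiplication $\star$ and bracket $\{-,-\}$ (the first three families being over $k_0$, the remaining ones over $k_1$): $k^2_{0,\delta}$: $e_1\star e_1=\delta e_2$, where $\delta\in k^*$; ${}_{\mu}k_0^2$: $\{e_1,e_2\}=\mu e_2$, where $\mu\in k$; $k^2_{0,u}$: $e_2\star e_2=u e_2$, where $u\in k^*$; $k_1^2$: $e_1\star e_1=e_1$; $\overline{k}_1^2$: $e_1\star e_1=e_1$, $e_1\star e_2=e_2\star e_1=e_2$; ${}_{\mu}k_1^2$: $e_1\star e_1=e_1$, $e_1\star e_2=e_2$, $\{e_1,e_2\}=\mu e_2$, where $\mu\in k$; ${}_{\mu}\overline{k}_1^2$: $e_1\star e_1=e_1$, $e_2\star e_1=e_2$, $\{e_1,e_2\}=\mu e_2$, where $\mu\in k$; $k_u^2$: $e_1\star e_1=e_1$, $e_2\star e_2=u e_2$, where $u\in k^*$.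
   Context: $k^*=k\setminus\{0\}$; everything is over $k$. Algebras are associative, not necessarily commutative or unital. A Poisson algebra is a vector space $P$ with an associative multiplication $pq$ and a Lie bracket $[-,-]$ such that $[pq,r]=[p,r]q+p[q,r]$ for all $p,q,r\in P$. When a Poisson algebra is given on a basis only the non-zero products and brackets are listed (up to antisymmetry of the bracket). $k_0$ is the $1$-dimensional vector space with zero product and zero bracket; $k_1$ is $k$ with its usual unital product and zero bracket. (Up to isomorphism these are the only 1-dimensional Poisson algebras.) A Poisson algebra $Q$ is a co-flag Poisson algebra over a Poisson algebra $P$ if there is a finite chain of epimorphisms of Poisson algebras $P_n:=Q\xrightarrow{\pi_n}P_{n-1}\to\cdots\to P_1\xrightarrow{\pi_1}P_0:=P\to0$ with $n\ge 1$ and $\dim_k\mathrm{Ker}(\pi_i)=1$ for all $i$. A finite dimensional Poisson algebra is a co-flag Poisson algebra if it is a co-flag Poisson algebra over $\{0\}$. Thus a 2-dimensional co-flag Poisson algebra $Q$ has an epimorphism $\pi:Q\to P_1$ with 1-dimensional $P_1$, which is identified with $k_0$ or $k_1$ via an isomorphism; $\mathrm{Ker}(\pi)$ is identified with $k e_2$ linearly. "Cohomologous to $R$", for $R$ in the list regarded with the projection $R\to P$, $e_1\mapsto y$, $e_2\mapsto 0$ ($P=k_0$ or $k_1$, with basis $y$, where $y=1$ for $k_1$), means that there is an isomorphism of Poisson algebras $Q\to R$ compatible with the identification of the kernels (it stabilizes the kernel) and with the projections onto $P$ (it co-stabilizes $P$). A crossed system of $P$ by a vector space $V$ is a system $(\rightharpoonup,\triangleleft,\vartheta,\cdot_V,\triangleright,f,[-,-]_V)$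 of bilinear maps $\rightharpoonup:P\times V\to V$, $\triangleleft:V\times P\to V$, $\vartheta:P\times P\to V$, $\cdot_V:V\times V\to V$, $\triangleright:P\times V\to V$, $f:P\times P\to V$, $[-,-]_V:V\times V\to V$ such that $P\times V$ with $(p,x)\star(q,y):=(pq,\ \vartheta(p,q)+p\rightharpoonup y+x\triangleleft q+x\cdot_V y)$ and $\{(p,x),(q,y)\}:=([p,q],\ f(p,q)+p\triangleright y-q\triangleright x+[x,y]_V)$ is a Poisson algebra. Two crossed systems (the second with primes) are cohomologous ($\approx$) if $\cdot_V=\cdot_V'$, $[-,-]_V=[-,-]_V'$ and there is a linear map $r:P\to V$ with, for all $p,q\in P$, $x\in V$: $p\rightharpoonup x=p\rightharpoonup' x+r(p)\cdot_V x$; $x\triangleleft p=x\triangleleft' p+x\cdot_V r(p)$; $\vartheta(p,q)=\vartheta'(p,q)+p\rightharpoonup' r(q)+r(p)\triangleleft' q-r(pq)+r(p)\cdot_V r(q)$; $p\triangleright x=p\triangleright' x+[r(p),x]_V$; $f(p,q)=f'(p,q)+p\triangleright' r(q)-q\triangleright' r(p)+[r(p),r(q)]_V-r([p,q])$. $\mathcal{GPH}^2(P,V)$ is the set of all crossed systems of $P$ by $V$ modulo $\approx$; here $V=k$ as a one-dimensional vector space. The symbol $\cong$ between sets denotes a bijection and $\sqcup$ disjoint union. *)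

theory Defs
  imports Complex_Main "HOL-Library.Product_Plus"
begin

text \<open>
  Vector spaces and Poisson algebras over a field are given by a carrier, which is a subspace of an
  ambient vector space: addition and zero are those of the ambient type, scalar multiplication
  is a record field. Only the values of the operations on the carrier matter.
\<close>

record ('k, 'a) vspace =
  carrier :: "'a set"
  scale :: "'k \<Rightarrow> 'a \<Rightarrow> 'a"

record ('k, 'a) palgebra = "('k, 'a) vspace" +
  prd :: "'a \<Rightarrow> 'a \<Rightarrow> 'a"
  brk :: "'a \<Rightarrow> 'a \<Rightarrow> 'a"

definition is_vspace :: "('k::field, 'a::ab_group_add, 'm) vspace_scheme \<Rightarrow> bool" where
  "is_vspace V \<longleftrightarrow> vector_space (scale V) \<and> module.subspace (scale V) (carrier V)"

definition vdim :: "('k::field, 'a::ab_group_add, 'm) vspace_scheme \<Rightarrow> nat" where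
  "vdim V = vector_space.dim (scale V) (carrier V)"

definition finite_dim :: "('k::field, 'a::ab_group_add, 'm) vspace_scheme \<Rightarrow> bool" where
  "finite_dim V \<longleftrightarrow> (\<exists>B. finite B \<and> module.span (scale V) B = carrier V)"

definition linear_map ::
  "('k::field, 'a::ab_group_add, 'm) vspace_scheme \<Rightarrow> ('k, 'b::ab_group_add, 'n) vspace_scheme
    \<Rightarrow> ('a \<Rightarrow> 'b) \<Rightarrow> bool" where
  "linear_map A B f \<longleftrightarrow>
     (\<forall>x\<in>carrier A. f x \<in> carrier B) \<and>
     (\<forall>x\<in>carrier A. \<forall>y\<in>carrier A. f (x + y) = f x + f y) \<and>
     (\<forall>c. \<forall>x\<in>carrier A. f (scale A c x) = scale B c (f x))"

definition linear_iso ::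
  "('k::field, 'a::ab_group_add, 'm) vspace_scheme \<Rightarrow> ('k, 'b::ab_group_add, 'n) vspace_scheme
    \<Rightarrow> ('a \<Rightarrow> 'b) \<Rightarrow> bool" where
  "linear_iso A B f \<longleftrightarrow> linear_map A B f \<and> bij_betw f (carrier A) (carrier B)"

definition bilinear_map ::
  "('k::field, 'a::ab_group_add, 'm) vspace_scheme \<Rightarrow> ('k, 'b::ab_group_add, 'n) vspace_scheme
    \<Rightarrow> ('k, 'c::ab_group_add, 'l) vspace_scheme \<Rightarrow> ('a \<Rightarrow> 'b \<Rightarrow> 'c) \<Rightarrow> bool" where
  "bilinear_map A B C h \<longleftrightarrow>
     (\<forall>x\<in>carrier A. linear_map B C (\<lambda>y. h x y)) \<and>
     (\<forall>y\<in>carrier B. linear_map A C (\<lambda>x. h x y))"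

text \<open>A Lie bracket is alternating, which in characteristic 2 is stronger than antisymmetric.\<close>

definition poisson_algebra :: "('k::field, 'a::ab_group_add) palgebra \<Rightarrow> bool" where
  "poisson_algebra A \<longleftrightarrow>
     is_vspace A \<and>
     bilinear_map A A A (prd A) \<and>
     (\<forall>p\<in>carrier A. \<forall>q\<in>carrier A. \<forall>r\<in>carrier A.
        prd A (prd A p q) r = prd A p (prd A q r)) \<and>
     bilinear_map A A A (brk A) \<and>
     (\<forall>p\<in>carrier A. brk A p p = 0) \<and>
     (\<forall>p\<in>carrier A. \<forall>q\<in>carrier A. \<forall>r\<in>carrier A.
        brk A p (brk A q r) + brk A q (brk A r p) + brk A r (brk A p q) = 0) \<and>
     (\<forall>p\<in>carrier A. \<forall>q\<in>carrier A. \<forall>r\<in>carrier A.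
        brk A (prd A p q) r = prd A (brk A p r) q + prd A p (brk A q r))"

definition poisson_hom ::
  "('k::field, 'a::ab_group_add) palgebra \<Rightarrow> ('k, 'b::ab_group_add) palgebra
    \<Rightarrow> ('a \<Rightarrow> 'b) \<Rightarrow> bool" where
  "poisson_hom A B f \<longleftrightarrow>
     linear_map A B f \<and>
     (\<forall>x\<in>carrier A. \<forall>y\<in>carrier A. f (prd A x y) = prd B (f x) (f y)) \<and>
     (\<forall>x\<in>carrier A. \<forall>y\<in>carrier A. f (brk A x y) = brk B (f x) (f y))"

definition poisson_epi ::
  "('k::field, 'a::ab_group_add) palgebra \<Rightarrow> ('k, 'b::ab_group_add) palgebra
    \<Rightarrow> ('a \<Rightarrow> 'b) \<Rightarrow> bool" where
  "poisson_epi A B f \<longleftrightarrow> poisson_hom A B f \<and> f ` carrier A = carrier B"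

definition poisson_iso ::
  "('k::field, 'a::ab_group_add) palgebra \<Rightarrow> ('k, 'b::ab_group_add) palgebra
    \<Rightarrow> ('a \<Rightarrow> 'b) \<Rightarrow> bool" where
  "poisson_iso A B f \<longleftrightarrow> poisson_hom A B f \<and> bij_betw f (carrier A) (carrier B)"

definition ker_space ::
  "('k::field, 'a::ab_group_add, 'm) vspace_scheme \<Rightarrow> ('a \<Rightarrow> 'b::ab_group_add)
    \<Rightarrow> ('k, 'a) vspace" where
  "ker_space A f = \<lparr>carrier = {x \<in> carrier A. f x = 0}, scale = scale A\<rparr>"

text \<open>
  The algebras of the chain all live in the ambient type of \<open>Q\<close>. This is no restriction: each of them
  is a quotient of \<open>Q\<close>, so its structure can be transported to a linear complement,
  inside the carrier of \<open>Q\<close>, of the kernel of the projection.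
\<close>

definition co_flag_over ::
  "('k::field, 'a::ab_group_add) palgebra \<Rightarrow> ('k, 'a) palgebra \<Rightarrow> bool" where
  "co_flag_over Q P \<longleftrightarrow>
     (\<exists>n\<ge>1. \<exists>(A :: nat \<Rightarrow> ('k, 'a) palgebra) (\<pi> :: nat \<Rightarrow> 'a \<Rightarrow> 'a).
        A n = Q \<and> A 0 = P \<and>
        (\<forall>i\<le>n. poisson_algebra (A i)) \<and>
        (\<forall>i\<in>{1..n}. poisson_epi (A i) (A (i - 1)) (\<pi> i) \<and>
                      vdim (ker_space (A i) (\<pi> i)) = 1))"

definition co_flag :: "('k::field, 'a::ab_group_add) palgebra \<Rightarrow> bool" where
  "co_flag Q \<longleftrightarrow>
     poisson_algebra Q \<and> finite_dim Q \<and> (\<exists>P. carrier P = {0} \<and> co_flag_over Q P)"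

definition extension ::
  "('k::field, 'p::ab_group_add) palgebra \<Rightarrow> ('k, 'v::ab_group_add) vspace
    \<Rightarrow> ('k, 'q::ab_group_add) palgebra \<Rightarrow> ('q \<Rightarrow> 'p) \<Rightarrow> ('v \<Rightarrow> 'q) \<Rightarrow> bool" where
  "extension P V Q \<pi> j \<longleftrightarrow>
     poisson_algebra Q \<and> poisson_epi Q P \<pi> \<and> linear_iso V (ker_space Q \<pi>) j"

text \<open>
  \<open>cohomologous_ext V Q \<pi> j R \<rho> l\<close>: there is an isomorphism from \<open>Q\<close> to \<open>R\<close> that stabilizes the
  kernels (identified with \<open>V\<close> by \<open>j\<close> and \<open>l\<close>) and co-stabilizes the common target of
  the projections \<open>\<pi>\<close> and \<open>\<rho>\<close>.
\<close>

definition cohomologous_ext ::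
  "('k::field, 'v::ab_group_add) vspace
    \<Rightarrow> ('k, 'q::ab_group_add) palgebra \<Rightarrow> ('q \<Rightarrow> 'p) \<Rightarrow> ('v \<Rightarrow> 'q)
    \<Rightarrow> ('k, 'r::ab_group_add) palgebra \<Rightarrow> ('r \<Rightarrow> 'p) \<Rightarrow> ('v \<Rightarrow> 'r) \<Rightarrow> bool" where
  "cohomologous_ext V Q \<pi> j R \<rho> l \<longleftrightarrow>
     (\<exists>\<psi>. poisson_iso Q R \<psi> \<and>
          (\<forall>x\<in>carrier V. \<psi> (j x) = l x) \<and>
          (\<forall>q\<in>carrier Q. \<rho> (\<psi> q) = \<pi> q))"

text \<open>
  The components, in order, of a crossed system: \<open>\<rightharpoonup>\<close>, \<open>\<triangleleft>\<close>, \<open>\<theta>\<close> (associative cocycle), the product of \<open>V\<close>, \<open>\<triangleright>\<close>, \<open>f\<close> (Lie cocycle),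
  the bracket of \<open>V\<close>.
\<close>

record ('p, 'v) csystem =
  lact :: "'p \<Rightarrow> 'v \<Rightarrow> 'v"
  ract :: "'v \<Rightarrow> 'p \<Rightarrow> 'v"
  theta :: "'p \<Rightarrow> 'p \<Rightarrow> 'v"
  vprd :: "'v \<Rightarrow> 'v \<Rightarrow> 'v"
  bact :: "'p \<Rightarrow> 'v \<Rightarrow> 'v"
  bcoc :: "'p \<Rightarrow> 'p \<Rightarrow> 'v"
  vbrk :: "'v \<Rightarrow> 'v \<Rightarrow> 'v"

definition crossed_product ::
  "('k::field, 'p::ab_group_add) palgebra \<Rightarrow> ('k, 'v::ab_group_add) vspace
    \<Rightarrow> ('p, 'v) csystem \<Rightarrow> ('k, 'p \<times> 'v) palgebra" where
  "crossed_product P V \<Omega> =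
     \<lparr>carrier = carrier P \<times> carrier V,
      scale = (\<lambda>c (p, x). (scale P c p, scale V c x)),
      prd = (\<lambda>(p, x) (q, y).
        (prd P p q, theta \<Omega> p q + lact \<Omega> p y + ract \<Omega> x q + vprd \<Omega> x y)),
      brk = (\<lambda>(p, x) (q, y).
        (brk P p q, bcoc \<Omega> p q + bact \<Omega> p y - bact \<Omega> q x + vbrk \<Omega> x y))\<rparr>"

definition crossed_systems ::
  "('k::field, 'p::ab_group_add) palgebra \<Rightarrow> ('k, 'v::ab_group_add) vspace
    \<Rightarrow> ('p, 'v) csystem set" where
  "crossed_systems P V =
     {\<Omega>. bilinear_map P V V (lact \<Omega>) \<and> bilinear_map V P V (ract \<Omega>) \<and>
          bilinear_map P P V (theta \<Omega>) \<and> bilinear_map V V V (vprd \<Omega>) \<and>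
          bilinear_map P V V (bact \<Omega>) \<and> bilinear_map P P V (bcoc \<Omega>) \<and>
          bilinear_map V V V (vbrk \<Omega>) \<and>
          poisson_algebra (crossed_product P V \<Omega>)}"

text \<open>
  All equalities are required on the carriers only, so systems whose maps agree on the carriers
  are identified in the quotient below.
\<close>

definition cohomologous_rel ::
  "('k::field, 'p::ab_group_add) palgebra \<Rightarrow> ('k, 'v::ab_group_add) vspace
    \<Rightarrow> (('p, 'v) csystem \<times> ('p, 'v) csystem) set" where
  "cohomologous_rel P V =
     {(\<Omega>, \<Omega>'). \<Omega> \<in> crossed_systems P V \<and> \<Omega>' \<in> crossed_systems P V \<and>
        (\<forall>x\<in>carrier V. \<forall>y\<in>carrier V. vprd \<Omega> x y = vprd \<Omega>' x y \<and> vbrk \<Omega> x y = vbrk \<Omega>' x y) \<and>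
        (\<exists>r. linear_map P V r \<and>
           (\<forall>p\<in>carrier P. \<forall>x\<in>carrier V.
              lact \<Omega> p x = lact \<Omega>' p x + vprd \<Omega>' (r p) x \<and>
              ract \<Omega> x p = ract \<Omega>' x p + vprd \<Omega>' x (r p) \<and>
              bact \<Omega> p x = bact \<Omega>' p x + vbrk \<Omega>' (r p) x) \<and>
           (\<forall>p\<in>carrier P. \<forall>q\<in>carrier P.
              theta \<Omega> p q = theta \<Omega>' p q + lact \<Omega>' p (r q) + ract \<Omega>' (r p) q
                             - r (prd P p q) + vprd \<Omega>' (r p) (r q) \<and>
              bcoc \<Omega> p q = bcoc \<Omega>' p q + bact \<Omega>' p (r q) - bact \<Omega>' q (r p)
                            + vbrk \<Omega>' (r p) (r q) - r (brk P p q)))}"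

definition GPH2 ::
  "('k::field, 'p::ab_group_add) palgebra \<Rightarrow> ('k, 'v::ab_group_add) vspace
    \<Rightarrow> ('p, 'v) csystem set set" where
  "GPH2 P V = crossed_systems P V // cohomologous_rel P V"

definition k_space :: "('k::field, 'k) vspace" where
  "k_space = \<lparr>carrier = UNIV, scale = (*)\<rparr>"

definition k0 :: "('k::field, 'k) palgebra" where
  "k0 = \<lparr>carrier = UNIV, scale = (*), prd = (\<lambda>_ _. 0), brk = (\<lambda>_ _. 0)\<rparr>"

definition k1 :: "('k::field, 'k) palgebra" where
  "k1 = \<lparr>carrier = UNIV, scale = (*), prd = (*), brk = (\<lambda>_ _. 0)\<rparr>"

definition smul2 :: "'k::field \<Rightarrow> 'k \<times> 'k \<Rightarrow> 'k \<times> 'k" where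
  "smul2 c v = (c * fst v, c * snd v)"

abbreviation (input) e1 :: "'k::field \<times> 'k" where "e1 \<equiv> (1, 0)"
abbreviation (input) e2 :: "'k::field \<times> 'k" where "e2 \<equiv> (0, 1)"

text \<open>
  The algebra with basis \<open>e1\<close>, \<open>e2\<close> in which the products of \<open>e1\<close>, \<open>e2\<close> are \<open>m11\<close>, \<open>m12\<close>, \<open>m21\<close>, \<open>m22\<close>
  (first index: left factor) and the bracket of \<open>e1\<close> with \<open>e2\<close> is \<open>b\<close>.
\<close>

definition alg2 ::
  "'k::field \<times> 'k \<Rightarrow> 'k \<times> 'k \<Rightarrow> 'k \<times> 'k \<Rightarrow> 'k \<times> 'k \<Rightarrow> 'k \<times> 'k
    \<Rightarrow> ('k, 'k \<times> 'k) palgebra" where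
  "alg2 m11 m12 m21 m22 b =
     \<lparr>carrier = UNIV,
      scale = smul2,
      prd = (\<lambda>(x1, x2) (y1, y2).
        smul2 (x1 * y1) m11 + smul2 (x1 * y2) m12 + smul2 (x2 * y1) m21 + smul2 (x2 * y2) m22),
      brk = (\<lambda>(x1, x2) (y1, y2). smul2 (x1 * y2 - x2 * y1) b)\<rparr>"

fun reps_k0 :: "'k::field + 'k + 'k \<Rightarrow> ('k, 'k \<times> 'k) palgebra" where
  "reps_k0 (Inl \<delta>) = alg2 (smul2 \<delta> e2) 0 0 0 0"
| "reps_k0 (Inr (Inl \<mu>)) = alg2 0 0 0 0 (smul2 \<mu> e2)"
| "reps_k0 (Inr (Inr u)) = alg2 0 0 0 (smul2 u e2) 0"

fun reps_k1 :: "unit + unit + 'k::field + 'k + 'k \<Rightarrow> ('k, 'k \<times> 'k) palgebra" where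
  "reps_k1 (Inl _) = alg2 e1 0 0 0 0"
| "reps_k1 (Inr (Inl _)) = alg2 e1 e2 e2 0 0"
| "reps_k1 (Inr (Inr (Inl \<mu>))) = alg2 e1 e2 0 0 (smul2 \<mu> e2)"
| "reps_k1 (Inr (Inr (Inr (Inl \<mu>)))) = alg2 e1 0 e2 0 (smul2 \<mu> e2)"
| "reps_k1 (Inr (Inr (Inr (Inr u)))) = alg2 e1 0 0 (smul2 u e2) 0"

definition params_k0 :: "('k::field + 'k + 'k) set" where
  "params_k0 = (UNIV - {0}) <+> UNIV <+> (UNIV - {0})"

definition params_k1 :: "(unit + unit + 'k::field + 'k + 'k) set" where
  "params_k1 = {()} <+> {()} <+> UNIV <+> UNIV <+> (UNIV - {0})"

end

theory Submission
  imports Defs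
begin

text \<open>
  A crossed system of a line by a line has seven bilinear structure maps on one-dimensional spaces, so
  seven scalars. The Lie cocycle and the bracket of the kernel are alternating, hence zero, and five
  scalars remain: the left and right actions \<open>a\<close> and \<open>b\<close>, the associative cocycle \<open>t\<close>, the product \<open>u\<close> of the
  kernel, and the Lie action \<open>m\<close>. Let \<open>\<epsilon>\<close> be \<open>0\<close> over \<open>k0\<close> and \<open>1\<close> over \<open>k1\<close>. The Poisson axioms become
  polynomial equations (\<open>poisson_algebra_line_system_iff\<close>):
  \<open>t a = t b\<close>, \<open>a\<^sup>2 = \<epsilon> a + t u\<close>, \<open>b\<^sup>2 = \<epsilon> b + t u\<close>, \<open>u a = u b\<close>, \<open>u m = 0\<close>, \<open>t m = 0\<close>, \<open>m (a + b - \<epsilon>) = 0\<close>.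
  Two systems are cohomologous when they differ by a shift of the section of the extension by a scalar \<open>s\<close>,
  which fixes \<open>u\<close> and \<open>m\<close>, adds \<open>u s\<close> to \<open>a\<close> and \<open>b\<close>, and adds \<open>(a + b - \<epsilon>) s + u s\<^sup>2\<close> to \<open>t\<close>
  (\<open>cohomologous_line_iff\<close>).

  If \<open>u \<noteq> 0\<close>, then \<open>a = b\<close> and \<open>m = 0\<close>, and the shift by \<open>a / u\<close> kills \<open>a\<close>, \<open>b\<close> and \<open>t\<close> at once; \<open>u\<close> is the
  only invariant. If \<open>u = 0\<close> and \<open>\<epsilon> = 0\<close>, then \<open>a = b = 0\<close>, nothing can be shifted, and \<open>t m = 0\<close>. If \<open>u = 0\<close> and
  \<open>\<epsilon> = 1\<close>, then \<open>a\<close> and \<open>b\<close> are \<open>0\<close> or \<open>1\<close>; for \<open>a = b\<close> the bracket vanishes and \<open>t\<close> can be shifted away, and for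
  \<open>a \<noteq> b\<close> the cocycle vanishes and \<open>m\<close> is free. This gives the lists of normal forms, which are pairwise
  not cohomologous.

  It remains to reduce algebras to crossed systems. A linear section of an extension
  of a line identifies it with a crossed product
  (\<open>extension_line_cohomologous_crossed_product\<close>), and the top step of the chain of a co-flag algebra of dimension
  two exhibits it as an extension of a line, which is \<open>k0\<close> or \<open>k1\<close> up to isomorphism
  (\<open>co_flag_dim_2_extension\<close>).
\<close>

section \<open>Linear maps and Poisson morphisms on carriers\<close>

lemma is_vspace_module:
  assumes "is_vspace A"
  shows "module (scale A)" "module.subspace (scale A) (carrier A)"
  using assms unfolding is_vspace_def vector_space_def module_def by simp_all

lemmas vspace_zero = module.subspace_0[OF is_vspace_module]
  and vspace_add = module.subspace_add[OF is_vspace_module]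
  and vspace_diff = module.subspace_diff[OF is_vspace_module]
  and vspace_scale = module.subspace_scale[OF is_vspace_module]

lemma linear_map_zero:
  assumes "linear_map A B f" "0 \<in> carrier A"
  shows "f 0 = 0"
proof -
  have "f (0 + 0) = f 0 + f 0"
    using assms unfolding linear_map_def by blast
  then show ?thesis by simp
qed

lemma linear_map_diff:
  assumes "linear_map A B f" "is_vspace A" "x \<in> carrier A" "y \<in> carrier A"
  shows "f (x - y) = f x - f y"
proof -
  have "f ((x - y) + y) = f (x - y) + f y"
    using assms vspace_diff unfolding linear_map_def by blast
  then show ?thesis by (simp add: algebra_simps)
qed

lemma linear_map_comp:
  assumes "linear_map A B f" "linear_map B C g"
  shows "linear_map A C (g \<circ> f)"
  using assms unfolding linear_map_def by simp

lemma linear_map_inv_into: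
  assumes f: "linear_map A B f" "bij_betw f (carrier A) (carrier B)" and A: "is_vspace A"
  shows "linear_map B A (inv_into (carrier A) f)"
proof -
  let ?g = "inv_into (carrier A) f"
  have g: "?g y \<in> carrier A" "f (?g y) = y" if "y \<in> carrier B" for y
    using that f(2) by (auto simp: bij_betw_def intro: inv_into_into f_inv_into_f)
  have inv: "?g (f x) = x" if "x \<in> carrier A" for x
    using that f(2) by (simp add: bij_betw_def)
  have "?g (x + y) = ?g x + ?g y" if "x \<in> carrier B" "y \<in> carrier B" for x y
  proof -
    have "f (?g x + ?g y) = x + y"
      using f(1) g that by (simp add: linear_map_def)
    then show ?thesis
      using inv vspace_add[OF A A] g that by metis
  qed
  moreover have "?g (scale B c x) = scale A c (?g x)" if "x \<in> carrier B" for c x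
  proof -
    have "f (scale A c (?g x)) = scale B c x"
      using f(1) g that by (simp add: linear_map_def)
    then show ?thesis
      using inv vspace_scale[OF A A] g that by metis
  qed
  ultimately show ?thesis
    using g(1) by (simp add: linear_map_def)
qed

lemma poisson_algebra_closed:
  assumes "poisson_algebra A" "x \<in> carrier A" "y \<in> carrier A"
  shows "prd A x y \<in> carrier A" "brk A x y \<in> carrier A"
  using assms by (simp_all add: poisson_algebra_def bilinear_map_def linear_map_def)

lemma poisson_hom_comp:
  assumes "poisson_hom A B f" "poisson_hom B C g"
  shows "poisson_hom A C (g \<circ> f)"
  using assms unfolding poisson_hom_def by (auto intro: linear_map_comp simp: linear_map_def)

lemma poisson_iso_comp:
  assumes "poisson_iso A B f" "poisson_iso B C g"
  shows "poisson_iso A C (g \<circ> f)"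
  using assms unfolding poisson_iso_def by (auto intro: bij_betw_trans poisson_hom_comp)

lemma poisson_iso_inv_into:
  assumes f: "poisson_iso A B f" and A: "poisson_algebra A"
  shows "poisson_iso B A (inv_into (carrier A) f)"
proof -
  let ?g = "inv_into (carrier A) f"
  have bij: "bij_betw f (carrier A) (carrier B)"
    using f by (simp add: poisson_iso_def)
  have g: "?g y \<in> carrier A" "f (?g y) = y" if "y \<in> carrier B" for y
    using that bij by (auto simp: bij_betw_def intro: inv_into_into f_inv_into_f)
  have inv: "?g (f x) = x" if "x \<in> carrier A" for x
    using that bij by (simp add: bij_betw_def)
  have "?g (prd B x y) = prd A (?g x) (?g y)" "?g (brk B x y) = brk A (?g x) (?g y)"
    if "x \<in> carrier B" "y \<in> carrier B" for x y
  proof -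
    have "f (prd A (?g x) (?g y)) = prd B x y" "f (brk A (?g x) (?g y)) = brk B x y"
      using f g that by (simp_all add: poisson_iso_def poisson_hom_def)
    then show "?g (prd B x y) = prd A (?g x) (?g y)" "?g (brk B x y) = brk A (?g x) (?g y)"
      using inv poisson_algebra_closed[OF A] g that by metis+
  qed
  moreover have "linear_map B A ?g"
    using f A bij by (intro linear_map_inv_into)
      (auto simp: poisson_iso_def poisson_hom_def poisson_algebra_def)
  ultimately show ?thesis
    using bij_betw_inv_into[OF bij] by (simp add: poisson_iso_def poisson_hom_def)
qed

text \<open>
  Any identity between values in \<open>A\<close> may be checked after applying the injective map \<open>f\<close>, where it becomes
  an identity for \<open>h\<close>. The same device transports all the Poisson laws in the next lemma, whose purpose
  is to see that an algebra defined by structure constants read off from a given Poisson algebra is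
  again a Poisson algebra.
\<close>

lemma bilinear_map_pullback:
  assumes f: "linear_map A B f" "inj_on f (carrier A)" and A: "is_vspace A"
    and h: "bilinear_map B B B h"
    and closed: "\<And>x y. x \<in> carrier A \<Longrightarrow> y \<in> carrier A \<Longrightarrow> h' x y \<in> carrier A"
    and hom: "\<And>x y. x \<in> carrier A \<Longrightarrow> y \<in> carrier A \<Longrightarrow> f (h' x y) = h (f x) (f y)"
  shows "bilinear_map A A A h'"
proof -
  note lin = f(1)[unfolded linear_map_def]
  note bil = h[unfolded bilinear_map_def linear_map_def]
  have "h' x (y + z) = h' x y + h' x z" "h' (y + z) x = h' y x + h' z x"
    if "x \<in> carrier A" "y \<in> carrier A" "z \<in> carrier A" for x y z
    using that lin bil by (auto intro!: inj_onD[OF f(2)] simp: hom closed vspace_add[OF A A])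
  moreover have "h' x (scale A c y) = scale A c (h' x y)" "h' (scale A c y) x = scale A c (h' y x)"
    if "x \<in> carrier A" "y \<in> carrier A" for x y c
    using that lin bil by (auto intro!: inj_onD[OF f(2)] simp: hom closed vspace_scale[OF A A])
  ultimately show ?thesis
    using closed by (simp add: bilinear_map_def linear_map_def)
qed

lemma poisson_algebra_pullback:
  assumes f: "poisson_hom A B f" "inj_on f (carrier A)" and A: "is_vspace A"
    and B: "poisson_algebra B"
    and closed: "\<And>x y. x \<in> carrier A \<Longrightarrow> y \<in> carrier A \<Longrightarrow> prd A x y \<in> carrier A"
      "\<And>x y. x \<in> carrier A \<Longrightarrow> y \<in> carrier A \<Longrightarrow> brk A x y \<in> carrier A"
  shows "poisson_algebra A"
proof -
  have lin: "linear_map A B f"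
    and hom: "\<And>x y. x \<in> carrier A \<Longrightarrow> y \<in> carrier A \<Longrightarrow> f (prd A x y) = prd B (f x) (f y)"
      "\<And>x y. x \<in> carrier A \<Longrightarrow> y \<in> carrier A \<Longrightarrow> f (brk A x y) = brk B (f x) (f y)"
    using f(1) by (auto simp: poisson_hom_def)
  have fB: "f x \<in> carrier B" and fadd: "y \<in> carrier A \<Longrightarrow> f (x + y) = f x + f y"
    if "x \<in> carrier A" for x y
    using lin that by (auto simp: linear_map_def)
  note add = vspace_add[OF A A]
  note zero = vspace_zero[OF A A]
  have "bilinear_map A A A (prd A)" "bilinear_map A A A (brk A)"
    using B hom closed
    by (auto simp: poisson_algebra_def intro: bilinear_map_pullback[OF lin f(2) A, of "prd B"]
        bilinear_map_pullback[OF lin f(2) A, of "brk B"])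
  moreover have "prd A (prd A p q) r = prd A p (prd A q r)"
    "brk A p (brk A q r) + brk A q (brk A r p) + brk A r (brk A p q) = 0"
    "brk A (prd A p q) r = prd A (brk A p r) q + prd A p (brk A q r)"
    if "p \<in> carrier A" "q \<in> carrier A" "r \<in> carrier A" for p q r
    using that B
    by (auto intro!: inj_onD[OF f(2)]
        simp: hom closed fB fadd add zero linear_map_zero[OF lin] poisson_algebra_def)
  moreover have "brk A p p = 0" if "p \<in> carrier A" for p
    using that B
    by (auto intro!: inj_onD[OF f(2)]
        simp: hom closed fB zero linear_map_zero[OF lin] poisson_algebra_def)
  ultimately show ?thesis
    using A by (simp add: poisson_algebra_def)
qed

section \<open>Cohomologous crossed systems and extensions\<close>

lemma cohomologous_ext_trans:
  assumes QR: "cohomologous_ext V Q \<pi> j R \<rho> l" and RS: "cohomologous_ext V R \<rho> l S \<sigma> m"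
  shows "cohomologous_ext V Q \<pi> j S \<sigma> m"
proof -
  from QR obtain f where f: "poisson_iso Q R f" "\<forall>x\<in>carrier V. f (j x) = l x"
    "\<forall>q\<in>carrier Q. \<rho> (f q) = \<pi> q"
    unfolding cohomologous_ext_def by blast
  from RS obtain g where g: "poisson_iso R S g" "\<forall>x\<in>carrier V. g (l x) = m x"
    "\<forall>q\<in>carrier R. \<sigma> (g q) = \<rho> q"
    unfolding cohomologous_ext_def by blast
  have "f q \<in> carrier R" if "q \<in> carrier Q" for q
    using f(1) that by (auto simp: poisson_iso_def bij_betw_def)
  then show ?thesis
    unfolding cohomologous_ext_def using poisson_iso_comp[OF f(1) g(1)] f g
    by (intro exI[of _ "g \<circ> f"]) simp
qed

lemma cohomologous_ext_sym:
  assumes QR: "cohomologous_ext V Q \<pi> j R \<rho> l" and Q: "poisson_algebra Q"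
    and j: "\<And>x. x \<in> carrier V \<Longrightarrow> j x \<in> carrier Q"
  shows "cohomologous_ext V R \<rho> l Q \<pi> j"
proof -
  from QR obtain f where f: "poisson_iso Q R f" "\<forall>x\<in>carrier V. f (j x) = l x"
    "\<forall>q\<in>carrier Q. \<rho> (f q) = \<pi> q"
    unfolding cohomologous_ext_def by blast
  let ?g = "inv_into (carrier Q) f"
  have inj: "inj_on f (carrier Q)" and im: "f ` carrier Q = carrier R"
    using f(1) by (auto simp: poisson_iso_def bij_betw_def)
  have "?g (l x) = j x" if "x \<in> carrier V" for x
    using that f(2) j inj by (metis inv_into_f_f)
  moreover have "\<pi> (?g q) = \<rho> q" if "q \<in> carrier R" for q
    using that f(3) im by (metis inv_into_into f_inv_into_f)
  ultimately show ?thesis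
    unfolding cohomologous_ext_def using poisson_iso_inv_into[OF f(1) Q] by blast
qed

text \<open>
  The five compatibility equations with \<open>r\<close> say exactly that \<open>(p, x) \<mapsto> (p, x + r p)\<close> respects products and
  brackets; this map is the identity on the kernel and lies over the identity of \<open>P\<close>. On the bracket
  side, skew symmetry of the bracket of \<open>V\<close> is what turns the term \<open>[r q, x]\<close> coming from \<open>q \<triangleright> x\<close> into the term
  \<open>[x, r q]\<close> of the expansion of \<open>[x + r p, y + r q]\<close>.
\<close>

lemma cohomologous_rel_imp_ext:
  assumes V: "is_vspace V" and rel: "(\<Omega>, \<Omega>') \<in> cohomologous_rel P V"
  shows "cohomologous_ext V (crossed_product P V \<Omega>) fst (\<lambda>x. (0, x))
           (crossed_product P V \<Omega>') fst (\<lambda>x. (0, x))"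
proof -
  from rel obtain r where r: "linear_map P V r"
    and sys: "\<Omega>' \<in> crossed_systems P V" "\<Omega> \<in> crossed_systems P V"
    and vv: "\<And>x y. x \<in> carrier V \<Longrightarrow> y \<in> carrier V \<Longrightarrow> vprd \<Omega> x y = vprd \<Omega>' x y"
      "\<And>x y. x \<in> carrier V \<Longrightarrow> y \<in> carrier V \<Longrightarrow> vbrk \<Omega> x y = vbrk \<Omega>' x y"
    and pv: "\<And>p x. p \<in> carrier P \<Longrightarrow> x \<in> carrier V \<Longrightarrow> lact \<Omega> p x = lact \<Omega>' p x + vprd \<Omega>' (r p) x"
      "\<And>p x. p \<in> carrier P \<Longrightarrow> x \<in> carrier V \<Longrightarrow> ract \<Omega> x p = ract \<Omega>' x p + vprd \<Omega>' x (r p)"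
      "\<And>p x. p \<in> carrier P \<Longrightarrow> x \<in> carrier V \<Longrightarrow> bact \<Omega> p x = bact \<Omega>' p x + vbrk \<Omega>' (r p) x"
    and pp: "\<And>p q. p \<in> carrier P \<Longrightarrow> q \<in> carrier P \<Longrightarrow>
        theta \<Omega> p q = theta \<Omega>' p q + lact \<Omega>' p (r q) + ract \<Omega>' (r p) q
                       - r (prd P p q) + vprd \<Omega>' (r p) (r q)"
      "\<And>p q. p \<in> carrier P \<Longrightarrow> q \<in> carrier P \<Longrightarrow>
        bcoc \<Omega> p q = bcoc \<Omega>' p q + bact \<Omega>' p (r q) - bact \<Omega>' q (r p)
                      + vbrk \<Omega>' (r p) (r q) - r (brk P p q)"
    unfolding cohomologous_rel_def by blast
  note rl = r[unfolded linear_map_def]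
  interpret vector_space "scale V" using V by (simp add: is_vspace_def)
  have add:
    "\<And>p x y. p \<in> carrier P \<Longrightarrow> x \<in> carrier V \<Longrightarrow> y \<in> carrier V \<Longrightarrow>
       lact \<Omega>' p (x + y) = lact \<Omega>' p x + lact \<Omega>' p y"
    "\<And>p x y. p \<in> carrier P \<Longrightarrow> x \<in> carrier V \<Longrightarrow> y \<in> carrier V \<Longrightarrow>
       ract \<Omega>' (x + y) p = ract \<Omega>' x p + ract \<Omega>' y p"
    "\<And>p x y. p \<in> carrier P \<Longrightarrow> x \<in> carrier V \<Longrightarrow> y \<in> carrier V \<Longrightarrow>
       bact \<Omega>' p (x + y) = bact \<Omega>' p x + bact \<Omega>' p y"
    "\<And>x y z. x \<in> carrier V \<Longrightarrow> y \<in> carrier V \<Longrightarrow> z \<in> carrier V \<Longrightarrow>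
       vprd \<Omega>' (x + y) z = vprd \<Omega>' x z + vprd \<Omega>' y z"
    "\<And>x y z. x \<in> carrier V \<Longrightarrow> y \<in> carrier V \<Longrightarrow> z \<in> carrier V \<Longrightarrow>
       vprd \<Omega>' z (x + y) = vprd \<Omega>' z x + vprd \<Omega>' z y"
    "\<And>x y z. x \<in> carrier V \<Longrightarrow> y \<in> carrier V \<Longrightarrow> z \<in> carrier V \<Longrightarrow>
       vbrk \<Omega>' (x + y) z = vbrk \<Omega>' x z + vbrk \<Omega>' y z"
    "\<And>x y z. x \<in> carrier V \<Longrightarrow> y \<in> carrier V \<Longrightarrow> z \<in> carrier V \<Longrightarrow>
       vbrk \<Omega>' z (x + y) = vbrk \<Omega>' z x + vbrk \<Omega>' z y"
    using sys(1) by (simp_all add: crossed_systems_def bilinear_map_def linear_map_def)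
  \<comment> \<open>On elements \<open>(0, x)\<close> the cocycle and the action drop out of the bracket of the crossed product,
    so its alternation becomes that of the bracket of \<open>V\<close>.\<close>
  have anti: "vbrk \<Omega>' x y = - vbrk \<Omega>' y x" if xy: "x \<in> carrier V" "y \<in> carrier V" for x y
  proof -
    have 0: "(0, 0) \<in> carrier P \<times> carrier V" and alt0: "bcoc \<Omega>' 0 0 = 0"
      "\<And>z. z \<in> carrier V \<Longrightarrow> brk (crossed_product P V \<Omega>') (0, z) (0, z) = 0"
    proof -
      have PA: "poisson_algebra (crossed_product P V \<Omega>')" and bil: "bilinear_map P P V (bcoc \<Omega>')"
        using sys(1) by (simp_all add: crossed_systems_def)
      then show 0: "(0, 0) \<in> carrier P \<times> carrier V"
        using vspace_zero[of "crossed_product P V \<Omega>'"]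
        by (simp add: poisson_algebra_def crossed_product_def zero_prod_def)
      then show "bcoc \<Omega>' 0 0 = 0"
        using bil linear_map_zero[of P V "bcoc \<Omega>' 0"] by (simp add: bilinear_map_def)
      show "brk (crossed_product P V \<Omega>') (0, z) (0, z) = 0" if "z \<in> carrier V" for z
        using PA 0 that by (simp add: poisson_algebra_def crossed_product_def)
    qed
    have alt: "vbrk \<Omega>' z z = 0" if "z \<in> carrier V" for z
      using alt0(2)[OF that] alt0(1) by (simp add: crossed_product_def zero_prod_def)
    have sum: "x + y \<in> carrier V" using xy by (rule vspace_add[OF V V])
    have "vbrk \<Omega>' (x + y) (x + y) = vbrk \<Omega>' x (x + y) + vbrk \<Omega>' y (x + y)"
      using xy sum by (intro add)
    also have "\<dots> = vbrk \<Omega>' x y + vbrk \<Omega>' y x"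
      using xy alt by (simp add: add)
    finally show ?thesis
      using alt[OF sum] by (simp add: eq_neg_iff_add_eq_0)
  qed
  \<comment> \<open>Needed for \<open>(p, x) \<mapsto> (p, x + r p)\<close> to fix the kernel.\<close>
  have r0: "r 0 = 0"
    using linear_map_zero[OF r] sys(1) vspace_zero[of "crossed_product P V \<Omega>'"]
    by (simp add: crossed_systems_def poisson_algebra_def crossed_product_def zero_prod_def)
  define \<psi> where "\<psi> = (\<lambda>(p, x). (p, x + r p))"
  have "bij_betw \<psi> (carrier P \<times> carrier V) (carrier P \<times> carrier V)"
    by (rule bij_betw_byWitness[where f' = "\<lambda>(p, x). (p, x - r p)"])
      (use rl in \<open>auto simp: \<psi>_def vspace_add[OF V V] vspace_diff[OF V V]\<close>)
  moreover have "linear_map (crossed_product P V \<Omega>) (crossed_product P V \<Omega>') \<psi>"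
    using rl by (auto simp: linear_map_def crossed_product_def \<psi>_def vspace_add[OF V V]
        scale_right_distrib)
  moreover have "\<psi> (prd (crossed_product P V \<Omega>) a b) = prd (crossed_product P V \<Omega>') (\<psi> a) (\<psi> b)"
    "\<psi> (brk (crossed_product P V \<Omega>) a b) = brk (crossed_product P V \<Omega>') (\<psi> a) (\<psi> b)"
    if ab: "a \<in> carrier P \<times> carrier V" "b \<in> carrier P \<times> carrier V" for a b
  proof -
    obtain p x q y where [simp]: "a = (p, x)" "b = (q, y)"
      and mem: "p \<in> carrier P" "x \<in> carrier V" "q \<in> carrier P" "y \<in> carrier V"
      using ab by auto
    have rmem: "r p \<in> carrier V" "r q \<in> carrier V" using rl mem by blast+
    show "\<psi> (prd (crossed_product P V \<Omega>) a b) = prd (crossed_product P V \<Omega>') (\<psi> a) (\<psi> b)"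
      by (simp add: crossed_product_def \<psi>_def add pp pv vv mem rmem vspace_add[OF V V])
    show "\<psi> (brk (crossed_product P V \<Omega>) a b) = brk (crossed_product P V \<Omega>') (\<psi> a) (\<psi> b)"
      using anti[OF mem(2) rmem(2)]
      by (simp add: crossed_product_def \<psi>_def add pp pv vv mem rmem vspace_add[OF V V])
  qed
  ultimately have "poisson_iso (crossed_product P V \<Omega>) (crossed_product P V \<Omega>') \<psi>"
    by (simp add: poisson_iso_def poisson_hom_def crossed_product_def)
  then show ?thesis
    unfolding cohomologous_ext_def using r0 by (intro exI[of _ \<psi>]) (auto simp: \<psi>_def crossed_product_def)
qed

section \<open>Crossed systems of a line by a line\<close>

text \<open>
  Treating \<open>k0\<close> and \<open>k1\<close> as the values at \<open>0\<close> and \<open>1\<close> of one family lets every computation below be done once.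
\<close>

definition line_algebra :: "'k::field \<Rightarrow> ('k, 'k) palgebra" where
  "line_algebra \<epsilon> = \<lparr>carrier = UNIV, scale = (*), prd = (\<lambda>p q. \<epsilon> * (p * q)), brk = (\<lambda>_ _. 0)\<rparr>"

lemma k0_eq_line_algebra: "k0 = line_algebra 0"
  and k1_eq_line_algebra: "k1 = line_algebra 1"
  by (simp_all add: k0_def k1_def line_algebra_def fun_eq_iff)

lemma line_algebra_simps [simp]:
  "carrier (line_algebra \<epsilon>) = UNIV" "scale (line_algebra \<epsilon>) = (*)"
  "prd (line_algebra \<epsilon>) p q = \<epsilon> * (p * q)" "brk (line_algebra \<epsilon>) p q = 0"
  by (simp_all add: line_algebra_def)

lemma k_space_simps [simp]: "carrier k_space = UNIV" "scale k_space = (*)"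
  by (simp_all add: k_space_def)

lemma vector_space_field: "vector_space ((*) :: 'k::field \<Rightarrow> 'k \<Rightarrow> 'k)"
  by unfold_locales (simp_all add: algebra_simps)

lemma is_vspace_line:
  assumes "carrier A = UNIV" "scale A = ((*) :: 'k::field \<Rightarrow> 'k \<Rightarrow> 'k)"
  shows "is_vspace A"
proof -
  interpret vector_space "(*) :: 'k \<Rightarrow> 'k \<Rightarrow> 'k" by (rule vector_space_field)
  show ?thesis using assms subspace_UNIV vector_space_field by (simp add: is_vspace_def)
qed

text \<open>
  The two remaining structure constants, those of the Lie cocycle and of the bracket of the kernel, are
  zero because both maps are alternating on a line.
\<close>

definition line_system :: "'k::field \<Rightarrow> 'k \<Rightarrow> 'k \<Rightarrow> 'k \<Rightarrow> 'k \<Rightarrow> ('k, 'k) csystem" where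
  "line_system a b t u m =
     \<lparr>lact = (\<lambda>p x. a * (p * x)), ract = (\<lambda>x p. b * (x * p)), theta = (\<lambda>p q. t * (p * q)),
      vprd = (\<lambda>x y. u * (x * y)), bact = (\<lambda>p x. m * (p * x)), bcoc = (\<lambda>_ _. 0),
      vbrk = (\<lambda>_ _. 0)\<rparr>"

lemma line_system_simps [simp]:
  "lact (line_system a b t u m) p x = a * (p * x)"
  "ract (line_system a b t u m) x p = b * (x * p)"
  "theta (line_system a b t u m) p q = t * (p * q)"
  "vprd (line_system a b t u m) x y = u * (x * y)"
  "bact (line_system a b t u m) p x = m * (p * x)"
  "bcoc (line_system a b t u m) p q = 0"
  "vbrk (line_system a b t u m) x y = 0"
  by (simp_all add: line_system_def)

lemma linear_map_line_iff:
  assumes "carrier A = UNIV" "scale A = (*)" "carrier B = UNIV" "scale B = (*)"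
  shows "linear_map A B f \<longleftrightarrow> (\<exists>c. f = (\<lambda>x :: 'k::field. c * x))"
proof
  assume f: "linear_map A B f"
  have "f x = f 1 * x" for x
  proof -
    have "f (scale A x 1) = scale B x (f 1)" using f assms(1) by (simp add: linear_map_def)
    then show ?thesis using assms by (simp add: mult.commute)
  qed
  then show "\<exists>c. f = (\<lambda>x. c * x)" by blast
next
  assume "\<exists>c. f = (\<lambda>x. c * x)"
  then show "linear_map A B f"
    using assms by (auto simp: linear_map_def algebra_simps)
qed

lemma bilinear_map_line_iff:
  assumes "carrier A = UNIV" "scale A = (*)" "carrier B = UNIV" "scale B = (*)"
    "carrier C = UNIV" "scale C = (*)"
  shows "bilinear_map A B C h \<longleftrightarrow> (\<exists>c. h = (\<lambda>x y :: 'k::field. c * (x * y)))"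
proof
  assume h: "bilinear_map A B C h"
  then have "\<exists>c. h x = (\<lambda>y. c * y)" for x
    using assms by (simp add: bilinear_map_def linear_map_line_iff[of B C])
  then have 1: "\<exists>d. \<forall>x y. h x y = d x * y" by metis
  have "\<exists>c. (\<lambda>x. h x 1) = (\<lambda>x. c * x)"
    using h assms by (simp add: bilinear_map_def linear_map_line_iff[of A C])
  then obtain c where 2: "\<And>x. h x 1 = c * x" by metis
  show "\<exists>c. h = (\<lambda>x y. c * (x * y))"
    using 1 2 by (intro exI[of _ c] ext) (metis mult.assoc mult_1_right)
next
  assume "\<exists>c. h = (\<lambda>x y. c * (x * y))"
  then show "bilinear_map A B C h"
    using assms by (auto simp: bilinear_map_def linear_map_def algebra_simps)
qed

lemma crossed_product_line_simps [simp]: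
  "carrier (crossed_product (line_algebra \<epsilon>) k_space \<Omega>) = UNIV"
  "scale (crossed_product (line_algebra \<epsilon>) k_space \<Omega>) c (p, x) = (c * p, c * x)"
  "prd (crossed_product (line_algebra \<epsilon>) k_space (line_system a b t u m)) (p, x) (q, y) =
     (\<epsilon> * (p * q), t * (p * q) + a * (p * y) + b * (x * q) + u * (x * y))"
  "brk (crossed_product (line_algebra \<epsilon>) k_space (line_system a b t u m)) (p, x) (q, y) =
     (0, m * (p * y - q * x))"
  by (simp_all add: crossed_product_def algebra_simps)

lemma is_vspace_crossed_product_line:
  "is_vspace (crossed_product (line_algebra \<epsilon>) k_space \<Omega>)" (is "is_vspace ?A")
proof -
  interpret vector_space "scale ?A"
    by unfold_locales (auto simp: algebra_simps)
  show ?thesis using subspace_UNIV by (simp add: is_vspace_def vector_space_axioms)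
qed

text \<open>
  Necessity is read off from the laws on the basis vectors \<open>(1, 0)\<close> and \<open>(0, 1)\<close>. Conversely, the defects of
  associativity and of the Leibniz rule on general elements are combinations, with monomial
  coefficients, of the listed equations. The first coordinates satisfy both laws in any case, so
  only the second coordinates have to be expanded.
\<close>

lemma poisson_algebra_line_system_iff:
  "poisson_algebra (crossed_product (line_algebra \<epsilon>) k_space (line_system a b t u m)) \<longleftrightarrow>
     t * a = t * b \<and> a\<^sup>2 = \<epsilon> * a + t * u \<and> b\<^sup>2 = \<epsilon> * b + t * u \<and> u * a = u * b \<and>
     u * m = 0 \<and> t * m = 0 \<and> m * (a + b - \<epsilon>) = 0"
    (is "poisson_algebra ?A \<longleftrightarrow> ?adm")
proof
  assume A: "poisson_algebra ?A"
  then have assoc: "prd ?A (prd ?A p q) r = prd ?A p (prd ?A q r)"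
    and leibniz: "brk ?A (prd ?A p q) r = prd ?A (brk ?A p r) q + prd ?A p (brk ?A q r)" for p q r
    unfolding poisson_algebra_def crossed_product_line_simps(1) by blast+
  show ?adm
    using assoc[of "(1, 0)" "(1, 0)" "(1, 0)"] assoc[of "(1, 0)" "(1, 0)" "(0, 1)"]
      assoc[of "(0, 1)" "(1, 0)" "(1, 0)"] assoc[of "(0, 1)" "(1, 0)" "(0, 1)"]
      leibniz[of "(1, 0)" "(0, 1)" "(0, 1)"] leibniz[of "(1, 0)" "(1, 0)" "(1, 0)"]
      leibniz[of "(1, 0)" "(1, 0)" "(0, 1)"]
    by (auto simp: algebra_simps power2_eq_square)
next
  assume adm: ?adm
  have "bilinear_map ?A ?A ?A (prd ?A)" "bilinear_map ?A ?A ?A (brk ?A)"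
    by (auto simp: bilinear_map_def linear_map_def algebra_simps)
  moreover have "prd ?A (prd ?A (p, x) (q, y)) (r, z) = prd ?A (p, x) (prd ?A (q, y) (r, z))"
    for p x q y r z
  proof -
    have "snd (prd ?A (prd ?A (p, x) (q, y)) (r, z)) - snd (prd ?A (p, x) (prd ?A (q, y) (r, z))) =
        (t * b - t * a) * (p * q * r) + (\<epsilon> * a + t * u - a\<^sup>2) * (p * q * z)
        + (b\<^sup>2 - (\<epsilon> * b + t * u)) * (x * q * r) + (u * b - u * a) * (x * q * z)"
      by (simp add: algebra_simps power2_eq_square)
    also have "\<dots> = 0" using adm by auto
    finally have "snd (prd ?A (prd ?A (p, x) (q, y)) (r, z)) = snd (prd ?A (p, x) (prd ?A (q, y) (r, z)))"
      by (simp only: right_minus_eq)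
    moreover have "fst (prd ?A (prd ?A (p, x) (q, y)) (r, z)) = fst (prd ?A (p, x) (prd ?A (q, y) (r, z)))"
      by (simp add: mult_ac)
    ultimately show ?thesis by (rule prod_eqI[rotated])
  qed
  moreover have "brk ?A (prd ?A (p, x) (q, y)) (r, z) =
      prd ?A (brk ?A (p, x) (r, z)) (q, y) + prd ?A (p, x) (brk ?A (q, y) (r, z))" for p x q y r z
  proof -
    have "snd (brk ?A (prd ?A (p, x) (q, y)) (r, z)) -
        snd (prd ?A (brk ?A (p, x) (r, z)) (q, y) + prd ?A (p, x) (brk ?A (q, y) (r, z))) =
        - (m * (a + b - \<epsilon>)) * (p * q * z) - (t * m) * (p * q * r)
        + (u * m) * (x * y * r - p * y * z - x * q * z)"
      by (simp add: algebra_simps power2_eq_square)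
    then show ?thesis using adm by simp
  qed
  moreover have "brk ?A (p, x) (p, x) = 0" for p x
    by (simp add: zero_prod_def)
  moreover have "brk ?A (p, x) (brk ?A (q, y) (r, z)) + brk ?A (q, y) (brk ?A (r, z) (p, x))
      + brk ?A (r, z) (brk ?A (p, x) (q, y)) = 0" for p x q y r z
    by (simp add: zero_prod_def algebra_simps)
  ultimately have "bilinear_map ?A ?A ?A (prd ?A) \<and> bilinear_map ?A ?A ?A (brk ?A) \<and>
      prd ?A (prd ?A P Q) R = prd ?A P (prd ?A Q R) \<and>
      brk ?A (prd ?A P Q) R = prd ?A (brk ?A P R) Q + prd ?A P (brk ?A Q R) \<and>
      brk ?A P P = 0 \<and>
      brk ?A P (brk ?A Q R) + brk ?A Q (brk ?A R P) + brk ?A R (brk ?A P Q) = 0" for P Q R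
    by (cases P, cases Q, cases R) (simp only: simp_thms)
  then show "poisson_algebra ?A"
    unfolding poisson_algebra_def using is_vspace_crossed_product_line by blast
qed

lemma line_system_mem_crossed_systems:
  "line_system a b t u m \<in> crossed_systems (line_algebra \<epsilon>) k_space \<longleftrightarrow>
     poisson_algebra (crossed_product (line_algebra \<epsilon>) k_space (line_system a b t u m))"
  by (simp add: crossed_systems_def bilinear_map_def linear_map_def algebra_simps)

lemma crossed_systems_line_iff:
  "\<Omega> \<in> crossed_systems (line_algebra \<epsilon>) k_space \<longleftrightarrow>
     (\<exists>a b t u m. \<Omega> = line_system a b t u m \<and>
        poisson_algebra (crossed_product (line_algebra \<epsilon>) k_space (line_system a b t u m)))"
    (is "?L \<longleftrightarrow> ?R")
proof
  assume L: ?L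
  let ?A = "crossed_product (line_algebra \<epsilon>) k_space \<Omega>"
  obtain a b t u m f v where \<Omega>:
    "lact \<Omega> = (\<lambda>p q. a * (p * q))" "ract \<Omega> = (\<lambda>p q. b * (p * q))"
    "theta \<Omega> = (\<lambda>p q. t * (p * q))" "vprd \<Omega> = (\<lambda>p q. u * (p * q))"
    "bact \<Omega> = (\<lambda>p q. m * (p * q))" "bcoc \<Omega> = (\<lambda>p q. f * (p * q))"
    "vbrk \<Omega> = (\<lambda>p q. v * (p * q))"
    using L by (auto simp: crossed_systems_def bilinear_map_line_iff)
  have alt: "brk ?A x x = 0" for x
    using L unfolding crossed_systems_def poisson_algebra_def crossed_product_line_simps(1) by blast
  have "f = 0" "v = 0"
    using alt[of "(1, 0)"] alt[of "(0, 1)"]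
    by (simp_all add: crossed_product_def zero_prod_def \<Omega>)
  then have "\<Omega> = line_system a b t u m"
    unfolding line_system_def by (intro csystem.equality) (simp_all add: \<Omega>)
  then show ?R using L unfolding crossed_systems_def by blast
next
  assume ?R
  then show ?L by (auto simp: line_system_mem_crossed_systems)
qed

text \<open>
  A linear map \<open>r\<close> from the line to the line is multiplication by a scalar \<open>s\<close>, and changing the section of
  the extension by \<open>s\<close> moves the parameters as follows. The product \<open>u\<close> of the kernel and the bracket
  parameter \<open>m\<close> never move; \<open>a\<close> and \<open>b\<close> move only when \<open>u \<noteq> 0\<close>.
\<close>

lemma cohomologous_line_iff:
  "(line_system a b t u m, line_system a' b' t' u' m') \<in> cohomologous_rel (line_algebra \<epsilon>) k_space \<longleftrightarrow>
     line_system a b t u m \<in> crossed_systems (line_algebra \<epsilon>) k_space \<and>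
     line_system a' b' t' u' m' \<in> crossed_systems (line_algebra \<epsilon>) k_space \<and>
     u = u' \<and> m = m' \<and>
     (\<exists>s. a = a' + u' * s \<and> b = b' + u' * s \<and> t = t' + (a' + b' - \<epsilon>) * s + u' * s\<^sup>2)"
    (is "?L \<longleftrightarrow> ?sys \<and> ?sys' \<and> ?R")
proof
  assume L: ?L
  then obtain r where "linear_map (line_algebra \<epsilon>) k_space r"
    and vv: "\<And>x y. u * (x * y) = u' * (x * y)"
    and pv: "\<And>p x. a * (p * x) = a' * (p * x) + u' * (r p * x)"
      "\<And>p x. b * (x * p) = b' * (x * p) + u' * (x * r p)" "\<And>p x. m * (p * x) = m' * (p * x)"
    and pp: "\<And>p q. t * (p * q) = t' * (p * q) + a' * (p * r q) + b' * (r p * q) - r (\<epsilon> * (p * q))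
        + u' * (r p * r q)"
    unfolding cohomologous_rel_def by auto
  then obtain s where s: "r = (\<lambda>x. s * x)" by (auto simp: linear_map_line_iff)
  have "u = u'" "a = a' + u' * s" "b = b' + u' * s" "m = m'"
    using vv[of 1 1] pv[of 1 1] by (simp_all add: s)
  moreover have "t = t' + (a' + b' - \<epsilon>) * s + u' * s\<^sup>2"
    using pp[of 1 1] by (simp add: s algebra_simps power2_eq_square)
  ultimately show "?sys \<and> ?sys' \<and> ?R"
    using L by (auto simp: cohomologous_rel_def)
next
  assume R: "?sys \<and> ?sys' \<and> ?R"
  then obtain s where s: "a = a' + u' * s" "b = b' + u' * s"
    "t = t' + (a' + b' - \<epsilon>) * s + u' * s\<^sup>2" by blast
  have "linear_map (line_algebra \<epsilon>) k_space ((*) s)" by (auto simp: linear_map_line_iff)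
  then show ?L using R unfolding cohomologous_rel_def
    by (auto simp: s algebra_simps power2_eq_square intro!: exI[of _ "(*) s"])
qed

text \<open>
  The shifts form a group action: \<open>0\<close>, \<open>- s\<close> and \<open>s + s'\<close> are the witnesses for the three axioms.
\<close>

lemma equiv_cohomologous_line:
  "equiv (crossed_systems (line_algebra \<epsilon>) k_space) (cohomologous_rel (line_algebra \<epsilon>) k_space)"
    (is "equiv ?X ?R")
proof (rule equivI)
  show sub: "?R \<subseteq> ?X \<times> ?X" by (auto simp: cohomologous_rel_def)
  have line: "\<exists>a b t u m. \<Omega> = line_system a b t u m" if "\<Omega> \<in> ?X" for \<Omega>
    using that unfolding crossed_systems_line_iff by blast
  show "refl_on ?X ?R"
  proof (intro refl_onI)
    fix \<Omega> assume "\<Omega> \<in> ?X"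
    then show "(\<Omega>, \<Omega>) \<in> ?R"
      using crossed_systems_line_iff[of \<Omega> \<epsilon>] by (auto simp: cohomologous_line_iff intro!: exI[of _ 0])
  qed
  show "sym ?R"
  proof (rule symI)
    fix \<Omega> \<Omega>' assume R: "(\<Omega>, \<Omega>') \<in> ?R"
    then have mem: "\<Omega> \<in> ?X" "\<Omega>' \<in> ?X" using sub by auto
    then obtain a b t u m a' b' t' u' m' where
      \<Omega>: "\<Omega> = line_system a b t u m" "\<Omega>' = line_system a' b' t' u' m'"
      using line[OF mem(1)] line[OF mem(2)] by auto
    from R obtain s where eq: "a = a' + u' * s" "b = b' + u' * s"
      "t = t' + (a' + b' - \<epsilon>) * s + u' * s\<^sup>2" "u = u'" "m = m'"
      unfolding \<Omega> cohomologous_line_iff by blast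
    have "a' = a + u * (- s)" "b' = b + u * (- s)" "t' = t + (a + b - \<epsilon>) * (- s) + u * (- s)\<^sup>2"
      by (simp_all add: eq algebra_simps power2_eq_square)
    then show "(\<Omega>', \<Omega>) \<in> ?R"
      using mem eq(4,5) unfolding \<Omega> cohomologous_line_iff by blast
  qed
  show "trans ?R"
  proof (rule transI)
    fix \<Omega> \<Omega>' \<Omega>'' assume R: "(\<Omega>, \<Omega>') \<in> ?R" "(\<Omega>', \<Omega>'') \<in> ?R"
    then have mem: "\<Omega> \<in> ?X" "\<Omega>' \<in> ?X" "\<Omega>'' \<in> ?X" using sub by auto
    then obtain a b t u m a' b' t' u' m' a'' b'' t'' u'' m'' where
      \<Omega>: "\<Omega> = line_system a b t u m" "\<Omega>' = line_system a' b' t' u' m'"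
        "\<Omega>'' = line_system a'' b'' t'' u'' m''"
      using line[OF mem(1)] line[OF mem(2)] line[OF mem(3)] by auto
    from R(1) obtain s where eq: "a = a' + u' * s" "b = b' + u' * s"
      "t = t' + (a' + b' - \<epsilon>) * s + u' * s\<^sup>2" "u = u'" "m = m'"
      unfolding \<Omega> cohomologous_line_iff by blast
    from R(2) obtain s' where eq': "a' = a'' + u'' * s'" "b' = b'' + u'' * s'"
      "t' = t'' + (a'' + b'' - \<epsilon>) * s' + u'' * s'\<^sup>2" "u' = u''" "m' = m''"
      unfolding \<Omega> cohomologous_line_iff by blast
    have "a = a'' + u'' * (s + s')" "b = b'' + u'' * (s + s')"
      "t = t'' + (a'' + b'' - \<epsilon>) * (s + s') + u'' * (s + s')\<^sup>2" "u = u''" "m = m''"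
      by (simp_all add: eq eq' algebra_simps power2_eq_square)
    then show "(\<Omega>, \<Omega>'') \<in> ?R"
      using mem unfolding \<Omega> cohomologous_line_iff by blast
  qed
qed

section \<open>Normal forms\<close>

lemma bij_betw_quotient_representatives:
  assumes eq: "equiv X R" and rep: "\<And>c. c \<in> C \<Longrightarrow> f c \<in> X"
    and ex: "\<And>x. x \<in> X \<Longrightarrow> \<exists>c\<in>C. (x, f c) \<in> R"
    and uniq: "\<And>c c'. c \<in> C \<Longrightarrow> c' \<in> C \<Longrightarrow> (f c, f c') \<in> R \<Longrightarrow> c = c'"
  shows "bij_betw (\<lambda>c. R `` {f c}) C (X // R)"
proof (rule bij_betwI')
  show "R `` {f c} = R `` {f c'} \<longleftrightarrow> c = c'" if "c \<in> C" "c' \<in> C" for c c'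
    using that uniq rep eq_equiv_class[OF _ eq] by blast
  show "R `` {f c} \<in> X // R" if "c \<in> C" for c
    using rep[OF that] by (rule quotientI)
  show "\<exists>c\<in>C. S = R `` {f c}" if "S \<in> X // R" for S
    using that ex equiv_class_eq[OF eq] by (metis quotientE)
qed

text \<open>
  The algebra listed for each parameter is itself the crossed product of one of these systems, so that
  comparing with the list amounts to comparing crossed systems.
\<close>

fun normal_system_k0 :: "'k::field + 'k + 'k \<Rightarrow> ('k, 'k) csystem" where
  "normal_system_k0 (Inl \<delta>) = line_system 0 0 \<delta> 0 0"
| "normal_system_k0 (Inr (Inl \<mu>)) = line_system 0 0 0 0 \<mu>"
| "normal_system_k0 (Inr (Inr u)) = line_system 0 0 0 u 0"

fun normal_system_k1 :: "unit + unit + 'k::field + 'k + 'k \<Rightarrow> ('k, 'k) csystem" where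
  "normal_system_k1 (Inl _) = line_system 0 0 0 0 0"
| "normal_system_k1 (Inr (Inl _)) = line_system 1 1 0 0 0"
| "normal_system_k1 (Inr (Inr (Inl \<mu>))) = line_system 1 0 0 0 \<mu>"
| "normal_system_k1 (Inr (Inr (Inr (Inl \<mu>)))) = line_system 0 1 0 0 \<mu>"
| "normal_system_k1 (Inr (Inr (Inr (Inr u)))) = line_system 0 0 0 u 0"

lemma reps_k0_eq: "reps_k0 c = crossed_product k0 k_space (normal_system_k0 c)"
  by (cases c rule: reps_k0.cases)
    (auto simp: alg2_def smul2_def crossed_product_def k0_def fun_eq_iff zero_prod_def algebra_simps)

lemma reps_k1_eq: "reps_k1 c = crossed_product k1 k_space (normal_system_k1 c)"
  by (cases c rule: reps_k1.cases)
    (auto simp: alg2_def smul2_def crossed_product_def k1_def fun_eq_iff zero_prod_def algebra_simps)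

lemma line_system_mem_iff:
  "line_system a b t u m \<in> crossed_systems (line_algebra \<epsilon>) k_space \<longleftrightarrow>
     t * a = t * b \<and> a\<^sup>2 = \<epsilon> * a + t * u \<and> b\<^sup>2 = \<epsilon> * b + t * u \<and> u * a = u * b \<and>
     u * m = 0 \<and> t * m = 0 \<and> m * (a + b - \<epsilon>) = 0"
  unfolding line_system_mem_crossed_systems by (rule poisson_algebra_line_system_iff)

lemma normal_system_k0_mem:
  "c \<in> params_k0 \<Longrightarrow> normal_system_k0 c \<in> crossed_systems (line_algebra 0) k_space"
  by (auto simp: params_k0_def line_system_mem_iff)

lemma normal_system_k1_mem:
  "c \<in> params_k1 \<Longrightarrow> normal_system_k1 c \<in> crossed_systems (line_algebra 1) k_space"
  by (auto simp: params_k1_def line_system_mem_iff)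

lemma normal_system_k0_inj:
  assumes "c \<in> params_k0" "c' \<in> params_k0"
    "(normal_system_k0 c, normal_system_k0 c') \<in> cohomologous_rel (line_algebra 0) k_space"
  shows "c = c'"
  using assms by (auto simp: params_k0_def cohomologous_line_iff)

lemma normal_system_k1_inj:
  assumes "c \<in> params_k1" "c' \<in> params_k1"
    "(normal_system_k1 c, normal_system_k1 c') \<in> cohomologous_rel (line_algebra 1) k_space"
  shows "c = c'"
  using assms by (auto simp: params_k1_def cohomologous_line_iff)

text \<open>
  If the kernel carries a nonzero product \<open>u\<close>, then \<open>e2 / u\<close> is an idempotent, and subtracting a
  multiple of it from the lift of \<open>e1\<close> makes the lift act by zero: the shift is \<open>s = a / u\<close>. The equation
  \<open>t * u = a\<^sup>2 - \<epsilon> * a\<close> says that this shift also removes the associative cocycle.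
\<close>

lemma line_system_absorb_actions:
  assumes mem: "line_system a b t u m \<in> crossed_systems (line_algebra \<epsilon>) k_space" and u: "u \<noteq> 0"
  shows "(line_system a b t u m, line_system 0 0 0 u 0) \<in> cohomologous_rel (line_algebra \<epsilon>) k_space"
proof -
  have "a = b" "m = 0" and t: "t * u = a\<^sup>2 - \<epsilon> * a"
    using mem u by (auto simp: line_system_mem_iff)
  moreover have "t = 0 + (0 + 0 - \<epsilon>) * (a / u) + u * (a / u)\<^sup>2"
    using t u by (simp add: field_simps power2_eq_square)
  ultimately show ?thesis
    using mem u by (auto simp: cohomologous_line_iff line_system_mem_iff intro!: exI[of _ "a / u"])
qed

text \<open>
  For \<open>u = 0\<close> both \<open>a\<close> and \<open>b\<close> have square zero, hence vanish, and \<open>t * m = 0\<close> leaves either a cocycle or a bracket.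
\<close>

lemma normal_system_k0_exhaustive:
  assumes "\<Omega> \<in> crossed_systems (line_algebra 0) k_space"
  shows "\<exists>c\<in>params_k0. (\<Omega>, normal_system_k0 c) \<in> cohomologous_rel (line_algebra 0) k_space"
proof -
  have refl: "(\<Omega>, \<Omega>) \<in> cohomologous_rel (line_algebra 0) k_space"
    using assms equiv_cohomologous_line equivE refl_onD by metis
  obtain a b t u m where \<Omega>: "\<Omega> = line_system a b t u m"
    using assms by (auto simp: crossed_systems_line_iff)
  show ?thesis
  proof (cases "u = 0")
    case False
    then show ?thesis
      using line_system_absorb_actions assms unfolding \<Omega>
      by (intro bexI[of _ "Inr (Inr u)"]) (auto simp: params_k0_def)
  next
    case True
    then have ab: "a = 0" "b = 0" "t * m = 0"
      using assms by (auto simp: \<Omega> line_system_mem_iff)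
    show ?thesis
    proof (cases "t = 0")
      case False
      then show ?thesis
        using ab True refl by (intro bexI[of _ "Inl t"]) (auto simp: \<Omega> params_k0_def)
    next
      case t: True
      then show ?thesis
        using ab True refl by (intro bexI[of _ "Inr (Inl m)"]) (auto simp: \<Omega> params_k0_def)
    qed
  qed
qed

text \<open>
  For \<open>u = 0\<close> the scalars \<open>a\<close> and \<open>b\<close> are idempotent, which gives four bimodule structures on the kernel. If
  \<open>a = b\<close>, then \<open>a + b - 1\<close> is \<open>1\<close> or \<open>- 1\<close>: this forces \<open>m = 0\<close> and allows a shift by \<open>\<plusminus> t\<close> to remove
  the cocycle. If \<open>a \<noteq> b\<close>, then \<open>a + b - 1 = 0\<close> and \<open>t = 0\<close>, so \<open>m\<close> is a free invariant.
\<close>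

lemma normal_system_k1_exhaustive:
  assumes "\<Omega> \<in> crossed_systems (line_algebra 1) k_space"
  shows "\<exists>c\<in>params_k1. (\<Omega>, normal_system_k1 c) \<in> cohomologous_rel (line_algebra 1) k_space"
proof -
  obtain a b t u m where \<Omega>: "\<Omega> = line_system a b t u m"
    using assms by (auto simp: crossed_systems_line_iff)
  show ?thesis
  proof (cases "u = 0")
    case False
    then show ?thesis
      using line_system_absorb_actions assms unfolding \<Omega>
      by (intro bexI[of _ "Inr (Inr (Inr (Inr u)))"]) (auto simp: params_k1_def)
  next
    case u: True
    then have "a * (a - 1) = 0" "b * (b - 1) = 0" and adm: "t * a = t * b" "t * m = 0"
      "m * (a + b - 1) = 0"
      using assms by (auto simp: \<Omega> line_system_mem_iff power2_eq_square algebra_simps)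
    then consider "a = 0" "b = 0" | "a = 1" "b = 1" | "a = 1" "b = 0" | "a = 0" "b = 1" by auto
    then show ?thesis
    proof cases
      case 1
      then show ?thesis
        using assms u adm unfolding \<Omega>
        by (intro bexI[of _ "Inl ()"])
          (auto simp: params_k1_def cohomologous_line_iff line_system_mem_iff intro: exI[of _ "- t"])
    next
      case 2
      then show ?thesis
        using assms u adm unfolding \<Omega>
        by (intro bexI[of _ "Inr (Inl ())"])
          (auto simp: params_k1_def cohomologous_line_iff line_system_mem_iff intro: exI[of _ t])
    next
      case 3
      then show ?thesis
        using assms u adm unfolding \<Omega>
        by (intro bexI[of _ "Inr (Inr (Inl m))"])
          (auto simp: params_k1_def cohomologous_line_iff line_system_mem_iff)
    next
      case 4
      then show ?thesis
        using assms u adm unfolding \<Omega>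
        by (intro bexI[of _ "Inr (Inr (Inr (Inl m)))"])
          (auto simp: params_k1_def cohomologous_line_iff line_system_mem_iff)
    qed
  qed
qed

section \<open>Extensions of a line\<close>

text \<open>
  Lift the basis vector of the base to \<open>w\<close> and let \<open>v\<close> span the kernel. Products and brackets of \<open>w\<close> and \<open>v\<close> lie
  in the kernel, except that \<open>w\<close> times \<open>w\<close> has to be corrected by \<open>\<epsilon> w\<close>; their coordinates are the
  structure constants of a crossed system, and \<open>(p, x) \<mapsto> p w + x v\<close> identifies its crossed product with \<open>Q\<close>.
\<close>

lemma extension_line_cohomologous_crossed_product:
  assumes ext: "extension (line_algebra \<epsilon>) k_space Q \<pi> j"
  shows "\<exists>\<Omega>\<in>crossed_systems (line_algebra \<epsilon>) k_space.
    cohomologous_ext k_space Q \<pi> j (crossed_product (line_algebra \<epsilon>) k_space \<Omega>) fst (\<lambda>x. (0, x))"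
proof -
  have Q: "poisson_algebra Q" and epi: "poisson_hom Q (line_algebra \<epsilon>) \<pi>" "\<pi> ` carrier Q = UNIV"
    and j: "linear_iso k_space (ker_space Q \<pi>) j"
    using ext by (simp_all add: extension_def poisson_epi_def)
  have V: "is_vspace Q" using Q by (simp add: poisson_algebra_def)
  note cl = poisson_algebra_closed[OF Q]
  interpret vector_space "scale Q" using V by (simp add: is_vspace_def)
  have lin: "linear_map Q (line_algebra \<epsilon>) \<pi>" using epi(1) by (simp add: poisson_hom_def)
  have \<pi>_prd: "\<pi> (prd Q x y) = \<epsilon> * (\<pi> x * \<pi> y)" and \<pi>_brk: "\<pi> (brk Q x y) = 0"
    and \<pi>_add: "\<pi> (x + y) = \<pi> x + \<pi> y"
    and \<pi>_diff: "\<pi> (x - y) = \<pi> x - \<pi> y"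
    if "x \<in> carrier Q" "y \<in> carrier Q" for x y
    using that epi(1) linear_map_diff[OF lin V] by (simp_all add: poisson_hom_def linear_map_def)
  have \<pi>_scale: "\<pi> (scale Q c x) = c * \<pi> x" if "x \<in> carrier Q" for x c
    using that lin by (simp add: linear_map_def)
  obtain w where w: "w \<in> carrier Q" "\<pi> w = 1" using epi(2) by (metis UNIV_I imageE)
  have j_lin: "linear_map k_space (ker_space Q \<pi>) j"
    and j_bij: "bij_betw j UNIV {x \<in> carrier Q. \<pi> x = 0}"
    using j by (simp_all add: linear_iso_def ker_space_def)
  have j_mem: "j x \<in> carrier Q" "\<pi> (j x) = 0" for x
    using j_bij by (auto simp: bij_betw_def)
  have j_inj: "j x = j y \<Longrightarrow> x = y" for x y
    using j_bij by (auto simp: bij_betw_def inj_def)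
  have j_scale: "j (c * x) = scale Q c (j x)" for x c
    using j_lin by (simp_all add: linear_map_def ker_space_def)
  have ker: "\<exists>x. q = j x" if "q \<in> carrier Q" "\<pi> q = 0" for q
    using that j_bij by (auto simp: bij_betw_def)
  define v where "v = j 1"
  have v: "v \<in> carrier Q" "\<pi> v = 0" using j_mem by (simp_all add: v_def)
  have jv: "j x = scale Q x v" for x using j_scale[of x 1] by (simp add: v_def)

  obtain a where a: "prd Q w v = j a"
    using ker[of "prd Q w v"] cl w v by (auto simp: \<pi>_prd)
  obtain b where b: "prd Q v w = j b"
    using ker[of "prd Q v w"] cl w v by (auto simp: \<pi>_prd)
  obtain u where u: "prd Q v v = j u"
    using ker[of "prd Q v v"] cl w v by (auto simp: \<pi>_prd)
  obtain t where "prd Q w w - scale Q \<epsilon> w = j t"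
    using ker[of "prd Q w w - scale Q \<epsilon> w"] cl w vspace_scale[OF V V w(1), of \<epsilon>]
      vspace_diff[OF V V]
    by (auto simp: \<pi>_prd \<pi>_diff \<pi>_scale)
  then have t: "prd Q w w = scale Q \<epsilon> w + j t" by (simp add: algebra_simps)
  obtain m where m: "brk Q w v = j m"
    using ker[of "brk Q w v"] cl w v by (auto simp: \<pi>_brk)
  have ww: "brk Q w w = 0" "brk Q v v = 0" and brk_bil: "bilinear_map Q Q Q (brk Q)"
    and prd_bil: "bilinear_map Q Q Q (prd Q)"
    using Q w v by (simp_all add: poisson_algebra_def)
  note mem = w(1) v(1) vspace_scale[OF V V] vspace_add[OF V V] cl
  have prd_expand: "prd Q (scale Q p w + scale Q x v) (scale Q q w + scale Q y v) =
      scale Q (p * q) (prd Q w w) + scale Q (p * y) (prd Q w v) + scale Q (x * q) (prd Q v w)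
      + scale Q (x * y) (prd Q v v)" for p x q y
    using prd_bil
    by (simp add: bilinear_map_def linear_map_def mem scale_right_distrib algebra_simps)
  have brk_expand: "brk Q (scale Q p w + scale Q x v) (scale Q q w + scale Q y v) =
      scale Q (p * q) (brk Q w w) + scale Q (p * y) (brk Q w v) + scale Q (x * q) (brk Q v w)
      + scale Q (x * y) (brk Q v v)" for p x q y
    using brk_bil
    by (simp add: bilinear_map_def linear_map_def mem scale_right_distrib algebra_simps)
  have vw: "brk Q v w = - brk Q w v"
  proof -
    have "brk Q (w + v) (w + v) = 0"
      using Q mem by (simp add: poisson_algebra_def)
    then have "brk Q w v + brk Q v w = 0"
      using brk_expand[of 1 1 1 1] ww by simp
    then show ?thesis by (simp add: eq_neg_iff_add_eq_0 add.commute)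
  qed

  define \<Omega> where "\<Omega> = line_system a b t u m"
  let ?C = "crossed_product (line_algebra \<epsilon>) k_space \<Omega>"
  define \<phi> where "\<phi> = (\<lambda>(p, x). scale Q p w + scale Q x v)"
  have \<phi>_mem: "\<phi> z \<in> carrier Q" for z
    by (cases z) (simp add: \<phi>_def mem)
  have \<pi>_\<phi>: "\<pi> (\<phi> z) = fst z" for z
    by (cases z) (simp add: \<phi>_def mem \<pi>_add \<pi>_scale w v)
  have bij: "bij_betw \<phi> UNIV (carrier Q)"
  proof (rule bij_betwI')
    show "\<phi> y = \<phi> z \<longleftrightarrow> y = z" for y z
    proof
      assume eq: "\<phi> y = \<phi> z"
      then have fst: "fst y = fst z" using \<pi>_\<phi> by metis
      with eq have "j (snd y) = j (snd z)" by (simp add: \<phi>_def jv case_prod_beta)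
      then show "y = z" using fst j_inj by (simp add: prod_eq_iff)
    qed simp
    show "\<phi> z \<in> carrier Q" for z by (rule \<phi>_mem)
    show "\<exists>z\<in>UNIV. q = \<phi> z" if q: "q \<in> carrier Q" for q
    proof -
      have "q - scale Q (\<pi> q) w \<in> carrier Q" "\<pi> (q - scale Q (\<pi> q) w) = 0"
        using q by (simp_all add: mem vspace_diff[OF V V] \<pi>_diff \<pi>_scale w(2))
      then obtain x where "q - scale Q (\<pi> q) w = j x" using ker by blast
      then have "q = \<phi> (\<pi> q, x)" by (simp add: \<phi>_def jv algebra_simps)
      then show ?thesis by blast
    qed
  qed
  have "linear_map ?C Q \<phi>"
    unfolding linear_map_def by (auto simp: \<phi>_mem) (auto simp: \<phi>_def algebra_simps)
  moreover have "\<phi> (prd ?C y z) = prd Q (\<phi> y) (\<phi> z)" "\<phi> (brk ?C y z) = brk Q (\<phi> y) (\<phi> z)" for y z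
    by (cases y; cases z;
        simp add: \<Omega>_def \<phi>_def prd_expand brk_expand a b u t m ww vw jv algebra_simps)+
  ultimately have hom: "poisson_hom ?C Q \<phi>" by (simp add: poisson_hom_def)
  have C: "poisson_algebra ?C"
    using hom Q bij
    by (intro poisson_algebra_pullback[where B = Q and f = \<phi>])
      (auto simp: bij_betw_def is_vspace_crossed_product_line)
  have "cohomologous_ext k_space ?C fst (\<lambda>x. (0, x)) Q \<pi> j"
    unfolding cohomologous_ext_def poisson_iso_def
    using hom bij \<pi>_\<phi> by (intro exI[of _ \<phi>]) (simp add: \<phi>_def jv)
  then have "cohomologous_ext k_space Q \<pi> j ?C fst (\<lambda>x. (0, x))"
    using C by (rule cohomologous_ext_sym) simp
  moreover have "\<Omega> \<in> crossed_systems (line_algebra \<epsilon>) k_space"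
    using C by (simp add: \<Omega>_def line_system_mem_crossed_systems)
  ultimately show ?thesis by blast
qed

section \<open>Co-flag algebras of dimension two\<close>

text \<open>
  The bracket vanishes on a line. If \<open>z\<close> times \<open>z\<close> is \<open>l z\<close> with \<open>l \<noteq> 0\<close>, then \<open>z / l\<close> is an idempotent; it
  is the image of \<open>1\<close> under the isomorphism from \<open>k1\<close>.
\<close>

lemma one_dim_poisson_algebra_cases:
  assumes A: "poisson_algebra A" and z: "z \<noteq> 0" and carr: "carrier A = range (\<lambda>c. scale A c z)"
  shows "\<exists>\<epsilon>\<in>{0, 1}. \<exists>f. poisson_iso (line_algebra \<epsilon>) A f"
proof -
  have V: "is_vspace A" using A by (simp add: poisson_algebra_def)
  interpret vector_space "scale A" using V by (simp add: is_vspace_def)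
  have z_mem: "z \<in> carrier A" unfolding carr using scale_one by (metis rangeI)
  obtain l where l: "prd A z z = scale A l z"
    using poisson_algebra_closed(1)[OF A z_mem z_mem] unfolding carr by blast
  have prd: "prd A (scale A c z) (scale A d z) = scale A (c * d) (prd A z z)"
    and brk: "brk A (scale A c z) (scale A d z) = 0" for c d
    using A z_mem vspace_scale[OF V V]
    by (simp_all add: poisson_algebra_def bilinear_map_def linear_map_def)
  \<comment> \<open>The multiple \<open>e z\<close> will be the image of \<open>1\<close>; for \<open>l = 0\<close> any nonzero \<open>e\<close> would do.\<close>
  define e where "e = (if l = 0 then 1 else inverse l)"
  define \<epsilon> :: 'a where "\<epsilon> = (if l = 0 then 0 else 1)"
  have e: "e \<noteq> 0" "e * e * l = \<epsilon> * e" by (simp_all add: e_def \<epsilon>_def)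
  define f where "f = (\<lambda>c. scale A (c * e) z)"
  have "linear_map (line_algebra \<epsilon>) A f"
    by (auto simp: linear_map_def f_def carr algebra_simps)
  moreover have "prd A (f c) (f d) = f (\<epsilon> * (c * d))" for c d
  proof -
    have "prd A (f c) (f d) = scale A (c * d * (e * e * l)) z"
      by (simp add: f_def prd l mult_ac)
    then show ?thesis unfolding e(2) by (simp add: f_def mult_ac)
  qed
  moreover have "brk A (f c) (f d) = 0" "f 0 = 0" for c d
    by (simp_all add: f_def brk)
  moreover have "bij_betw f UNIV (carrier A)"
  proof (rule bij_betwI')
    show "f c = f d \<longleftrightarrow> c = d" for c d using e z by (simp add: f_def)
    show "f c \<in> carrier A" for c by (auto simp: f_def carr)
    show "\<exists>c\<in>UNIV. x = f c" if x: "x \<in> carrier A" for x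
    proof -
      obtain d where "x = scale A d z" using x carr by blast
      then have "x = f (d / e)" using e by (simp add: f_def)
      then show ?thesis by blast
    qed
  qed
  ultimately have "poisson_iso (line_algebra \<epsilon>) A f"
    by (simp add: poisson_iso_def poisson_hom_def)
  moreover have "\<epsilon> \<in> {0, 1}" by (simp add: \<epsilon>_def)
  ultimately show ?thesis by blast
qed

text \<open>
  Rank and nullity, in the explicit form needed for carriers: a generator of the kernel is completed to a
  basis of \<open>Q\<close>, whose second member maps to a generator of the image.
\<close>

lemma epi_onto_one_dim:
  assumes Q: "is_vspace Q" "vdim Q = 2" and \<pi>: "linear_map Q A \<pi>" "\<pi> ` carrier Q = carrier A"
    and A: "is_vspace A" and ker: "vdim (ker_space Q \<pi>) = 1"
  shows "\<exists>v z. z \<noteq> 0 \<and> v \<noteq> 0 \<and> carrier A = range (\<lambda>c. scale A c z) \<and>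
    {x \<in> carrier Q. \<pi> x = 0} = range (\<lambda>c. scale Q c v)"
proof -
  interpret vector_space "scale Q" using Q by (simp add: is_vspace_def)
  interpret A: vector_space "scale A" using A by (simp add: is_vspace_def)
  let ?K = "{x \<in> carrier Q. \<pi> x = 0}"
  have sub: "subspace (carrier Q)" using Q by (simp add: is_vspace_def)
  have K: "subspace ?K"
    using sub \<pi>(1) linear_map_zero[OF \<pi>(1)] by (auto simp: subspace_def linear_map_def)
  obtain B0 where B0: "B0 \<subseteq> ?K" "independent B0" "?K \<subseteq> span B0" "card B0 = dim ?K"
    by (rule basis_exists)
  have "card B0 = 1" using ker B0(4) by (simp add: vdim_def ker_space_def)
  then obtain v where v: "B0 = {v}" by (auto simp: card_1_singleton_iff)
  have vK: "?K = range (\<lambda>c. scale Q c v)"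
    using B0 span_minimal[OF B0(1) K] by (auto simp: v span_singleton)
  have v0: "v \<noteq> 0" using B0(2) v dependent_zero by blast
  obtain B where B: "B0 \<subseteq> B" "B \<subseteq> carrier Q" "independent B" "carrier Q \<subseteq> span B"
    using maximal_independent_subset_extend[of B0 "carrier Q"] B0 by blast
  have "card B = dim (carrier Q)"
    using B(2,4,3) by (rule basis_card_eq_dim)
  then have "card B = 2" using Q(2) by (simp add: vdim_def)
  then obtain w where w: "B = {v, w}" "w \<noteq> v"
    using B(1) v by (auto simp: card_2_iff)
  have w_mem: "w \<in> carrier Q" and v_mem: "v \<in> carrier Q" "\<pi> v = 0"
    using B(2) w B0(1) v by auto
  have "\<pi> w \<noteq> 0"
  proof
    assume "\<pi> w = 0"
    then have "w \<in> span (B - {w})" using vK w_mem w by (auto simp: span_singleton insert_Diff_if)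
    then show False using B(3) w unfolding dependent_def by blast
  qed
  moreover have "carrier A = range (\<lambda>c. scale A c (\<pi> w))"
  proof
    show "carrier A \<subseteq> range (\<lambda>c. scale A c (\<pi> w))"
    proof
      fix y assume "y \<in> carrier A"
      then obtain q where q: "q \<in> carrier Q" "y = \<pi> q" using \<pi>(2) by auto
      have "q \<in> span {v, w}" using B(4) q w by auto
      then obtain c d where "q - scale Q c v = scale Q d w"
        by (auto simp: span_breakdown_eq[of q v] span_singleton)
      then have "q = scale Q c v + scale Q d w" by (simp add: algebra_simps)
      then have "y = scale A d (\<pi> w)"
        using \<pi>(1) v_mem w_mem vspace_scale[OF Q(1) Q(1)] q by (simp add: linear_map_def)
      then show "y \<in> range (\<lambda>c. scale A c (\<pi> w))" by blast
    qed
    show "range (\<lambda>c. scale A c (\<pi> w)) \<subseteq> carrier A"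
      using \<pi> w_mem vspace_scale[OF A A] by auto
  qed
  ultimately show ?thesis using v0 vK by blast
qed

text \<open>
  Only the top step \<open>A n \<rightarrow> A (n - 1)\<close> of the chain matters: its kernel is a line and \<open>A n\<close> is a plane, so \<open>A (n - 1)\<close> is
  a line.
\<close>

lemma co_flag_dim_2_extension:
  assumes "co_flag Q" "vdim Q = 2"
  shows "\<exists>\<epsilon>\<in>{0, 1}. \<exists>\<pi> j. extension (line_algebra \<epsilon>) k_space Q \<pi> j"
proof -
  from assms(1) obtain n A \<pi>s where n: "n \<ge> (1::nat)" "A n = Q"
    "\<And>i. i \<le> n \<Longrightarrow> poisson_algebra (A i)"
    "\<And>i. i \<in> {1..n} \<Longrightarrow> poisson_epi (A i) (A (i - 1)) (\<pi>s i) \<and> vdim (ker_space (A i) (\<pi>s i)) = 1"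
    unfolding co_flag_def co_flag_over_def by blast
  define \<pi> where "\<pi> = \<pi>s n"
  define P where "P = A (n - 1)"
  have Q: "poisson_algebra Q" and P: "poisson_algebra P"
    and epi: "poisson_epi Q P \<pi>" and ker: "vdim (ker_space Q \<pi>) = 1"
    using n(3)[of n] n(3)[of "n - 1"] n(4)[of n] n(1,2) by (simp_all add: \<pi>_def P_def)
  have lin: "linear_map Q P \<pi>" and im: "\<pi> ` carrier Q = carrier P"
    using epi by (simp_all add: poisson_epi_def poisson_hom_def)
  have V: "is_vspace Q" "is_vspace P" using Q P by (simp_all add: poisson_algebra_def)
  obtain v z where z: "z \<noteq> 0" "carrier P = range (\<lambda>c. scale P c z)"
    and v: "v \<noteq> 0" "{x \<in> carrier Q. \<pi> x = 0} = range (\<lambda>c. scale Q c v)"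
    using epi_onto_one_dim[OF V(1) assms(2) lin im V(2) ker] by blast
  obtain \<epsilon> f where \<epsilon>: "\<epsilon> \<in> {0, 1}" and f: "poisson_iso (line_algebra \<epsilon>) P f"
    using one_dim_poisson_algebra_cases[OF P z] by blast
  have line: "poisson_algebra (line_algebra \<epsilon>)"
    using f P
    by (intro poisson_algebra_pullback[where B = P and f = f])
      (auto simp: poisson_iso_def bij_betw_def is_vspace_line)
  let ?g = "inv_into UNIV f"
  have g: "poisson_iso P (line_algebra \<epsilon>) ?g"
    using poisson_iso_inv_into[OF f line] by simp
  have "?g x = 0 \<longleftrightarrow> x = 0" if "x \<in> carrier P" for x
  proof -
    have "?g 0 = 0"
      using g linear_map_zero vspace_zero[OF V(2) V(2)] by (auto simp: poisson_iso_def poisson_hom_def)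
    moreover have "inj_on ?g (carrier P)" using g by (simp add: poisson_iso_def bij_betw_def)
    ultimately show ?thesis using that vspace_zero[OF V(2) V(2)] by (metis inj_onD)
  qed
  then have ker_eq: "{x \<in> carrier Q. (?g \<circ> \<pi>) x = 0} = range (\<lambda>c. scale Q c v)"
    unfolding v(2)[symmetric] im[symmetric] by auto
  have "poisson_epi Q (line_algebra \<epsilon>) (?g \<circ> \<pi>)"
    using epi g im unfolding poisson_epi_def poisson_iso_def bij_betw_def image_comp[symmetric]
    by (auto intro: poisson_hom_comp)
  moreover have "linear_iso k_space (ker_space Q (?g \<circ> \<pi>)) (\<lambda>c. scale Q c v)"
  proof -
    interpret vector_space "scale Q" using V by (simp add: is_vspace_def)
    show ?thesis
      unfolding linear_iso_def linear_map_def ker_space_def ker_eq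
      using v(1) by (auto simp: algebra_simps bij_betw_def inj_def)
  qed
  ultimately show ?thesis using \<epsilon> Q unfolding extension_def by blast
qed

section \<open>The classification\<close>

text \<open>
  A complete irredundant list of normal forms both parametrizes the cohomology classes and
  classifies the extensions, since every extension is cohomologous to a crossed product.
\<close>

lemma GPH2_line_classification:
  fixes f :: "'c \<Rightarrow> ('k::field, 'k) csystem"
  assumes mem: "\<And>c. c \<in> C \<Longrightarrow> f c \<in> crossed_systems (line_algebra \<epsilon>) k_space"
    and uniq: "\<And>c c'. c \<in> C \<Longrightarrow> c' \<in> C \<Longrightarrow>
      (f c, f c') \<in> cohomologous_rel (line_algebra \<epsilon>) k_space \<Longrightarrow> c = c'"
    and exhaustive: "\<And>\<Omega>. \<Omega> \<in> crossed_systems (line_algebra \<epsilon>) k_space \<Longrightarrow>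
      \<exists>c\<in>C. (\<Omega>, f c) \<in> cohomologous_rel (line_algebra \<epsilon>) k_space"
    and R: "\<And>c. R c = crossed_product (line_algebra \<epsilon>) k_space (f c)"
  shows "\<exists>\<Phi>. bij_betw \<Phi> C (GPH2 (line_algebra \<epsilon>) k_space) \<and>
      (\<forall>c\<in>C. \<forall>\<Omega>\<in>\<Phi> c. cohomologous_ext k_space
         (crossed_product (line_algebra \<epsilon>) k_space \<Omega>) fst (\<lambda>x. (0, x)) (R c) fst (\<lambda>x. (0, x)))"
    and "extension (line_algebra \<epsilon>) k_space Q \<pi> j \<Longrightarrow>
      \<exists>c\<in>C. cohomologous_ext k_space Q \<pi> j (R c) fst (\<lambda>x. (0, x))"
proof -
  let ?rel = "cohomologous_rel (line_algebra \<epsilon>) k_space"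
  have V: "is_vspace (k_space :: ('k, 'k) vspace)" by (simp add: is_vspace_line)
  have "bij_betw (\<lambda>c. ?rel `` {f c}) C (GPH2 (line_algebra \<epsilon>) k_space)"
    unfolding GPH2_def using equiv_cohomologous_line mem exhaustive uniq
    by (rule bij_betw_quotient_representatives)
  moreover have "cohomologous_ext k_space
      (crossed_product (line_algebra \<epsilon>) k_space \<Omega>) fst (\<lambda>x. (0, x)) (R c) fst (\<lambda>x. (0, x))"
    if "\<Omega> \<in> ?rel `` {f c}" for c \<Omega>
  proof -
    have "(\<Omega>, f c) \<in> ?rel"
      using that equiv_cohomologous_line[of \<epsilon>] by (auto elim: equivE dest: symD)
    then show ?thesis unfolding R by (rule cohomologous_rel_imp_ext[OF V])
  qed
  ultimately show "\<exists>\<Phi>. bij_betw \<Phi> C (GPH2 (line_algebra \<epsilon>) k_space) \<and>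
      (\<forall>c\<in>C. \<forall>\<Omega>\<in>\<Phi> c. cohomologous_ext k_space
         (crossed_product (line_algebra \<epsilon>) k_space \<Omega>) fst (\<lambda>x. (0, x)) (R c) fst (\<lambda>x. (0, x)))"
    by blast
  show "\<exists>c\<in>C. cohomologous_ext k_space Q \<pi> j (R c) fst (\<lambda>x. (0, x))"
    if "extension (line_algebra \<epsilon>) k_space Q \<pi> j"
    using extension_line_cohomologous_crossed_product[OF that] exhaustive
      cohomologous_rel_imp_ext[OF V] unfolding R by (meson cohomologous_ext_trans)
qed

theorem corollary3p8:
  shows
    "(\<exists>\<Phi>. bij_betw \<Phi> params_k0 (GPH2 (k0 :: ('k::field, 'k) palgebra) k_space) \<and>
        (\<forall>c\<in>params_k0. \<forall>\<Omega>\<in>\<Phi> c.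
           cohomologous_ext k_space
             (crossed_product k0 k_space \<Omega>) fst (\<lambda>x. (0, x))
             (reps_k0 c) fst (\<lambda>x. (0, x)))) \<and>
     (\<exists>\<Phi>. bij_betw \<Phi> params_k1 (GPH2 (k1 :: ('k, 'k) palgebra) k_space) \<and>
        (\<forall>c\<in>params_k1. \<forall>\<Omega>\<in>\<Phi> c.
           cohomologous_ext k_space
             (crossed_product k1 k_space \<Omega>) fst (\<lambda>x. (0, x))
             (reps_k1 c) fst (\<lambda>x. (0, x)))) \<and>
     (\<forall>Q :: ('k, 'q::ab_group_add) palgebra. co_flag Q \<and> vdim Q = 2 \<longrightarrow>
        ((\<exists>\<pi> j. extension k0 k_space Q \<pi> j) \<or> (\<exists>\<pi> j. extension k1 k_space Q \<pi> j)) \<and>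
        (\<forall>\<pi> j. extension k0 k_space Q \<pi> j \<longrightarrow>
           (\<exists>c\<in>params_k0. cohomologous_ext k_space Q \<pi> j (reps_k0 c) fst (\<lambda>x. (0, x)))) \<and>
        (\<forall>\<pi> j. extension k1 k_space Q \<pi> j \<longrightarrow>
           (\<exists>c\<in>params_k1. cohomologous_ext k_space Q \<pi> j (reps_k1 c) fst (\<lambda>x. (0, x)))))"
proof (intro conjI allI impI)
  note k0 = GPH2_line_classification[OF normal_system_k0_mem normal_system_k0_inj
      normal_system_k0_exhaustive reps_k0_eq[unfolded k0_eq_line_algebra],
      folded k0_eq_line_algebra]
  note k1 = GPH2_line_classification[OF normal_system_k1_mem normal_system_k1_inj
      normal_system_k1_exhaustive reps_k1_eq[unfolded k1_eq_line_algebra],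
      folded k1_eq_line_algebra]
  show "\<exists>\<Phi>. bij_betw \<Phi> params_k0 (GPH2 (k0 :: ('k, 'k) palgebra) k_space) \<and>
      (\<forall>c\<in>params_k0. \<forall>\<Omega>\<in>\<Phi> c. cohomologous_ext k_space
         (crossed_product k0 k_space \<Omega>) fst (\<lambda>x. (0, x)) (reps_k0 c) fst (\<lambda>x. (0, x)))"
    by (rule k0(1))
  show "\<exists>\<Phi>. bij_betw \<Phi> params_k1 (GPH2 (k1 :: ('k, 'k) palgebra) k_space) \<and>
      (\<forall>c\<in>params_k1. \<forall>\<Omega>\<in>\<Phi> c. cohomologous_ext k_space
         (crossed_product k1 k_space \<Omega>) fst (\<lambda>x. (0, x)) (reps_k1 c) fst (\<lambda>x. (0, x)))"
    by (rule k1(1))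
  fix Q :: "('k, 'q) palgebra"
  show "(\<exists>\<pi> j. extension k0 k_space Q \<pi> j) \<or> (\<exists>\<pi> j. extension k1 k_space Q \<pi> j)"
    if "co_flag Q \<and> vdim Q = 2"
    using that co_flag_dim_2_extension[of Q] by (auto simp: k0_eq_line_algebra k1_eq_line_algebra)
  show "\<exists>c\<in>params_k0. cohomologous_ext k_space Q \<pi> j (reps_k0 c) fst (\<lambda>x. (0, x))"
    if "extension k0 k_space Q \<pi> j" for \<pi> j
    by (rule k0(2)) (fact that | assumption)+
  show "\<exists>c\<in>params_k1. cohomologous_ext k_space Q \<pi> j (reps_k1 c) fst (\<lambda>x. (0, x))"
    if "extension k1 k_space Q \<pi> j" for \<pi> j
    by (rule k1(2)) (fact that | assumption)+
qed

end
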